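(* (MacMahon Master Theorem.) Let $M=(M_{ij})$ be the generator matrix of the right quantum superalgebra $\mathcal{M}_{m|n}$. For every $k\ge 1$ the following identities hold in $\mathcal{M}_{m|n}$: $$\sum_{r=0}^k(-1)^r\,\mathrm{str}_{1,\dots,k}\,\mathcal{H}_r^q\,\mathcal{A}^q_{\{r+1,\dots,k\}}M_1\cdots M_k=0,$$ $$\sum_{r=0}^k(-1)^r\,\mathrm{str}_{1,\dots,k}\,\mathcal{A}_r^q\,\mathcal{H}^q_{\{r+1,\dots,k\}}M_1\cdots M_k=0.$$
   Context: Let $q$ be a nonzero parameter and $m,n\ge 0$ integers. $\mathbb{C}^{m|n}$ is the $\mathbb{Z}_2$-graded space with basis $e_1,\dots,e_{m+n}$, where $e_i$ has parity $\bar i=0$ for $i\le m$ and $\bar i=1$ for $i>m$; the matrix units $E_{ij}$ have parity $\bar i+\bar j$. Put $\varepsilon(a)=1,0,-1$ according to $a>0$, $a=0$, $a<0$. Tensor products of superalgebras use the sign rule $(a\otimes b)(c\otimes d)=(-1)^{\bar b\bar c}ac\otimes bd$. Define $P^q=\sum_{i,j=1}^{m+n}q^{\varepsilon(i-j)}(-1)^{\bar j}E_{ij}\otimes E_{ji}$. It satisfies $(P^q)^2=1$ and the braid relation. Let $P^q_{a,a+1}\in\mathrm{End}(\mathbb{C}^{m|n})^{\otimes k}$ be $P^q$ placed in the tensor factors $a,a+1$. For $\sigma\in\mathfrak{S}_k$ with reduced decomposition $\sigma=s_{i_1}\cdots s_{i_l}$, $s_i=(i,i+1)$, put $P_\sigma^q=P^q_{i_1,i_1+1}\cdots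 P^q_{i_l,i_l+1}$, and $$\mathcal{A}_k^q=\frac1{k!}\sum_{\sigma\in\mathfrak{S}_k}\mathrm{sgn}(\sigma)P^q_\sigma,\qquad \mathcal{H}_k^q=\frac1{k!}\sum_{\sigma\in\mathfrak{S}_k}P^q_\sigma .$$ $\mathcal{A}_r^q,\mathcal{H}_r^q$ act in the tensor factors $1,\dots,r$, while $\mathcal{A}^q_{\{r+1,\dots,k\}}$, $\mathcal{H}^q_{\{r+1,\dots,k\}}$ denote the $q$-antisymmetrizer and $q$-symmetrizer over the copies of $\mathrm{End}(\mathbb{C}^{m|n})$ labelled $r+1,\dots,k$ (over an empty set of copies each of these operators is $1$). The right quantum superalgebra $\mathcal{M}_{m|n}$ is the unital associative superalgebra generated by $M_{ij}$, $1\le i,j\le m+n$, of parity $\bar i+\bar j$, with defining relations written in matrix form as $(1-P^q)M_1M_2(1+P^q)=0$. Here, for $1\le a\le k$, $$M_a=\sum_{i,j}(-1)^{\bar i\bar j+\bar j}M_{ij}\otimes 1^{\otimes(a-1)}\otimes E_{ij}\otimes 1^{\otimes(k-a)}\in\mathcal{M}_{m|n}\otimes\mathrm{End}(\mathbb{C}^{m|n})^{\otimes k}.$$ The supertrace on $\mathrm{End}(\mathbb{C}^{m|n})$ is $\mathrm{str}(E_{ij})=\delta_{ij}(-1)^{\bar i}$; $\mathrm{str}_{1,\dots,k}$ is the supertrace taken over all $k$ copies of $\mathrm{End}(\mathbb{C}^{m|n})$, i.e. $\mathrm{str}_{1,\dots,k}(y\otimes E_{i_1j_1}\otimes\cdots\otimes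 E_{i_kj_k})=y\prod_a\delta_{i_aj_a}(-1)^{\bar i_a}$. *)

theory Defs
  imports
    Complex_Main
    "HOL-Library.Poly_Mapping"
    "HOL-Library.FuncSet"
    "HOL-Combinatorics.Permutations"
    "HOL-Algebra.Module"
    "HOL-Algebra.QuotRing"
begin

section \<open>Superalgebras over the complex numbers\<close>

text \<open>
  The field \<open>homog\<close> gives the homogeneous subspaces of parity \<open>0\<close> and \<open>1\<close>; its value at other
  numbers is irrelevant.
\<close>

record 'a superalgebra = "(complex, 'a) module" +
  homog :: "nat \<Rightarrow> 'a set"

definition component :: "('a, 'z) superalgebra_scheme \<Rightarrow> nat \<Rightarrow> 'a \<Rightarrow> 'a" where
  "component A p x = (THE y. y \<in> homog A p \<and> (\<exists>z \<in> homog A (1 - p). x = y \<oplus>\<^bsub>A\<^esub> z))"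

text \<open>
  The quotient by a homogeneous two-sided ideal. A two-sided ideal of a unital algebra is a
  subspace, so the scalar multiple of a coset below is again a coset.
\<close>

definition quotient_superalgebra :: "'a superalgebra \<Rightarrow> 'a set \<Rightarrow> 'a set superalgebra" where
  "quotient_superalgebra A I =
    \<lparr>carrier = carrier (A Quot I),
     mult = mult (A Quot I),
     one = one (A Quot I),
     zero = zero (A Quot I),
     add = add (A Quot I),
     smult = (\<lambda>c X. \<Union>x\<in>X. I +>\<^bsub>A\<^esub> (c \<odot>\<^bsub>A\<^esub> x)),
     homog = (\<lambda>p. (\<lambda>x. I +>\<^bsub>A\<^esub> x) ` homog A p)\<rparr>"


section \<open>The free superalgebra on the generators \<open>M\<^sub>i\<^sub>j\<close>\<close>

definition par :: "nat \<Rightarrow> nat \<Rightarrow> nat" where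
  "par m i = (if i \<le> m then 0 else 1)"

text \<open>
  Words form a monoid under concatenation, written additively so that the convolution product
  of \<open>Poly_Mapping\<close> makes \<open>'a word \<Rightarrow>\<^sub>0 complex\<close> the free associative algebra.
\<close>

datatype 'a word = Word (letters: "'a list")

instantiation word :: (type) monoid_add
begin

definition zero_word :: "'a word" where
  "0 = Word []"

definition plus_word :: "'a word \<Rightarrow> 'a word \<Rightarrow> 'a word" where
  "u + v = Word (letters u @ letters v)"

instance
  by standard (simp_all add: zero_word_def plus_word_def)

end

definition word_par :: "nat \<Rightarrow> (nat \<times> nat) word \<Rightarrow> nat" where
  "word_par m w = (\<Sum>(i, j)\<leftarrow>letters w. par m i + par m j) mod 2"

definition free_carrier :: "nat \<Rightarrow> nat \<Rightarrow> ((nat \<times> nat) word \<Rightarrow>\<^sub>0 complex) set" where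
  "free_carrier m n =
    {f. \<forall>w \<in> Poly_Mapping.keys f. set (letters w) \<subseteq> {1..m + n} \<times> {1..m + n}}"

definition free_superalgebra ::
    "nat \<Rightarrow> nat \<Rightarrow> ((nat \<times> nat) word \<Rightarrow>\<^sub>0 complex) superalgebra" where
  "free_superalgebra m n =
    \<lparr>carrier = free_carrier m n,
     mult = (*),
     one = 1,
     zero = 0,
     add = (+),
     smult = (\<lambda>c f. Poly_Mapping.single 0 c * f),
     homog = (\<lambda>p. {f \<in> free_carrier m n. \<forall>w \<in> Poly_Mapping.keys f. word_par m w = p})\<rparr>"

definition free_gen :: "nat \<Rightarrow> nat \<Rightarrow> ((nat \<times> nat) word \<Rightarrow>\<^sub>0 complex)" where
  "free_gen i j = Poly_Mapping.single (Word [(i, j)]) 1"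


section \<open>The superalgebra \<open>A \<otimes> End(\<complex>\<^bsup>m|n\<^esup>)\<^bsup>\<otimes>k\<^esup>\<close>\<close>

text \<open>
  An element is given by its coefficient function: \<open>X I J\<close> is the coefficient in \<open>A\<close> of
  \<open>E\<^bsub>I 1, J 1\<^esub> \<otimes> \<dots> \<otimes> E\<^bsub>I k, J k\<^esub>\<close>.
\<close>

definition multi_idx :: "nat \<Rightarrow> nat \<Rightarrow> nat \<Rightarrow> (nat \<Rightarrow> nat) set" where
  "multi_idx m n k = ({1..k} \<rightarrow>\<^sub>E {1..m + n})"

definition unit_par :: "nat \<Rightarrow> nat \<Rightarrow> (nat \<Rightarrow> nat) \<Rightarrow> (nat \<Rightarrow> nat) \<Rightarrow> nat" where
  "unit_par m k I J = (\<Sum>a = 1..k. par m (I a) + par m (J a))"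

text \<open>
  Sign exponent of \<open>(E\<^bsub>I 1, J 1\<^esub> \<otimes> \<dots> \<otimes> E\<^bsub>I k, J k\<^esub>) (E\<^bsub>J 1, L 1\<^esub> \<otimes> \<dots> \<otimes> E\<^bsub>J k, L k\<^esub>)\<close>:
  the factor \<open>b\<close> on the right moves past the factors \<open>a > b\<close> on the left.
\<close>

definition cross_par ::
    "nat \<Rightarrow> nat \<Rightarrow> (nat \<Rightarrow> nat) \<Rightarrow> (nat \<Rightarrow> nat) \<Rightarrow> (nat \<Rightarrow> nat) \<Rightarrow> nat" where
  "cross_par m k I J L =
    (\<Sum>a = 1..k. \<Sum>b = 1..<a. (par m (I a) + par m (J a)) * (par m (J b) + par m (L b)))"

text \<open>
  In the product, the parity \<open>p\<close> component of the coefficient on the right moves past the whole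
  matrix unit on the left.
\<close>

definition tensor_End ::
    "('a, 'z) superalgebra_scheme \<Rightarrow> nat \<Rightarrow> nat \<Rightarrow> nat \<Rightarrow>
      (complex, (nat \<Rightarrow> nat) \<Rightarrow> (nat \<Rightarrow> nat) \<Rightarrow> 'a) module" where
  "tensor_End A m n k =
    (let K = multi_idx m n k;
         coeffs = (\<lambda>X I J. if I \<in> K \<and> J \<in> K then X I J else \<zero>\<^bsub>A\<^esub>)
     in
    \<lparr>carrier = {X. (\<forall>I \<in> K. \<forall>J \<in> K. X I J \<in> carrier A) \<and> coeffs X = X},
     mult = (\<lambda>X Y. coeffs (\<lambda>I L.
       \<Oplus>\<^bsub>A\<^esub>J \<in> K. \<Oplus>\<^bsub>A\<^esub>p \<in> {0, 1}.
         ((- 1) ^ (unit_par m k I J * p + cross_par m k I J L)) \<odot>\<^bsub>A\<^esub>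
           (X I J \<otimes>\<^bsub>A\<^esub> component A p (Y J L)))),
     one = coeffs (\<lambda>I J. if I = J then \<one>\<^bsub>A\<^esub> else \<zero>\<^bsub>A\<^esub>),
     zero = (\<lambda>I J. \<zero>\<^bsub>A\<^esub>),
     add = (\<lambda>X Y. coeffs (\<lambda>I J. X I J \<oplus>\<^bsub>A\<^esub> Y I J)),
     smult = (\<lambda>c X. coeffs (\<lambda>I J. c \<odot>\<^bsub>A\<^esub> X I J))\<rparr>)"

definition supertrace ::
    "('a, 'z) superalgebra_scheme \<Rightarrow> nat \<Rightarrow> nat \<Rightarrow> nat \<Rightarrow>
      ((nat \<Rightarrow> nat) \<Rightarrow> (nat \<Rightarrow> nat) \<Rightarrow> 'a) \<Rightarrow> 'a" where
  "supertrace A m n k X =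
    (\<Oplus>\<^bsub>A\<^esub>I \<in> multi_idx m n k. ((- 1) ^ (\<Sum>a = 1..k. par m (I a))) \<odot>\<^bsub>A\<^esub> X I I)"

definition ordered_prod :: "('a, 'z) monoid_scheme \<Rightarrow> 'a list \<Rightarrow> 'a" where
  "ordered_prod G xs = foldr (mult G) xs \<one>\<^bsub>G\<^esub>"


section \<open>The operators \<open>P\<^bsup>q\<^esup>\<close>, the \<open>q\<close>-symmetrizer and the \<open>q\<close>-antisymmetrizer\<close>

text \<open>
  \<open>P_op A m n q k a\<close> is \<open>1 \<otimes> P\<^bsup>q\<^esup>\<close> with \<open>P\<^bsup>q\<^esup>\<close> in the tensor factors \<open>a\<close> and \<open>a + 1\<close>. Its nonzero
  coefficients, those of \<open>\<dots> \<otimes> E\<^bsub>ij\<^esub> \<otimes> E\<^bsub>ji\<^esub> \<otimes> \<dots>\<close>, are at \<open>I a = J (a + 1) = i\<close>,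
  \<open>I (a + 1) = J a = j\<close>, with \<open>I\<close> and \<open>J\<close> equal elsewhere.
\<close>

definition P_op ::
    "('a, 'z) superalgebra_scheme \<Rightarrow> nat \<Rightarrow> nat \<Rightarrow> complex \<Rightarrow> nat \<Rightarrow> nat \<Rightarrow>
      (nat \<Rightarrow> nat) \<Rightarrow> (nat \<Rightarrow> nat) \<Rightarrow> 'a" where
  "P_op A m n q k a I J =
    (if I \<in> multi_idx m n k \<and> J \<in> multi_idx m n k \<and>
        I a = J (a + 1) \<and> I (a + 1) = J a \<and> (\<forall>b \<in> {1..k} - {a, a + 1}. I b = J b)
     then (q powi sgn (int (I a) - int (J a)) * (- 1) ^ par m (J a)) \<odot>\<^bsub>A\<^esub> \<one>\<^bsub>A\<^esub>
     else \<zero>\<^bsub>A\<^esub>)"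

text \<open>
  \<open>s\<^sub>i\<^sub>1 \<cdots> s\<^sub>i\<^sub>l\<close> for the list \<open>[i\<^sub>1, \<dots>, i\<^sub>l]\<close>.
\<close>

definition word_perm :: "nat list \<Rightarrow> nat \<Rightarrow> nat" where
  "word_perm w = foldr (\<circ>) (map (\<lambda>i. transpose i (i + 1)) w) id"

definition reduced_decomp :: "nat \<Rightarrow> nat \<Rightarrow> (nat \<Rightarrow> nat) \<Rightarrow> nat list \<Rightarrow> bool" where
  "reduced_decomp a b \<sigma> w \<longleftrightarrow>
    set w \<subseteq> {a..<b} \<and> word_perm w = \<sigma> \<and>
    (\<forall>v. set v \<subseteq> {a..<b} \<and> word_perm v = \<sigma> \<longrightarrow> length w \<le> length v)"

text \<open>
  Here \<open>\<sigma>\<close> permutes \<open>{a..b}\<close>. The operators \<open>P\<^bsup>q\<^esup>\<close> satisfy the braid relations, so the choice of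
  the reduced decomposition does not matter.
\<close>

definition P_perm ::
    "('a, 'z) superalgebra_scheme \<Rightarrow> nat \<Rightarrow> nat \<Rightarrow> complex \<Rightarrow> nat \<Rightarrow> nat \<Rightarrow> nat \<Rightarrow> (nat \<Rightarrow> nat) \<Rightarrow>
      (nat \<Rightarrow> nat) \<Rightarrow> (nat \<Rightarrow> nat) \<Rightarrow> 'a" where
  "P_perm A m n q k a b \<sigma> =
    ordered_prod (tensor_End A m n k)
      (map (P_op A m n q k) (SOME w. reduced_decomp a b \<sigma> w))"

text \<open>
  The \<open>q\<close>-symmetrizer and \<open>q\<close>-antisymmetrizer over the tensor factors \<open>a, \<dots>, b\<close>; no factor is
  involved if \<open>b < a\<close>.
\<close>

definition q_sym ::
    "('a, 'z) superalgebra_scheme \<Rightarrow> nat \<Rightarrow> nat \<Rightarrow> complex \<Rightarrow> nat \<Rightarrow> nat \<Rightarrow> nat \<Rightarrow>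
      (nat \<Rightarrow> nat) \<Rightarrow> (nat \<Rightarrow> nat) \<Rightarrow> 'a" where
  "q_sym A m n q k a b =
    (1 / fact (card {a..b})) \<odot>\<^bsub>tensor_End A m n k\<^esub>
      (\<Oplus>\<^bsub>tensor_End A m n k\<^esub>\<sigma> \<in> {\<sigma>. \<sigma> permutes {a..b}}. P_perm A m n q k a b \<sigma>)"

definition q_antisym ::
    "('a, 'z) superalgebra_scheme \<Rightarrow> nat \<Rightarrow> nat \<Rightarrow> complex \<Rightarrow> nat \<Rightarrow> nat \<Rightarrow> nat \<Rightarrow>
      (nat \<Rightarrow> nat) \<Rightarrow> (nat \<Rightarrow> nat) \<Rightarrow> 'a" where
  "q_antisym A m n q k a b =
    (1 / fact (card {a..b})) \<odot>\<^bsub>tensor_End A m n k\<^esub>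
      (\<Oplus>\<^bsub>tensor_End A m n k\<^esub>\<sigma> \<in> {\<sigma>. \<sigma> permutes {a..b}}.
        of_int (sign \<sigma>) \<odot>\<^bsub>tensor_End A m n k\<^esub> P_perm A m n q k a b \<sigma>)"


section \<open>The right quantum superalgebra\<close>

text \<open>
  The element \<open>M\<^sub>a\<close> built from a matrix \<open>M\<close> over \<open>A\<close>. The coefficients of
  \<open>1\<^bsup>\<otimes>(a-1)\<^esup> \<otimes> E\<^bsub>ij\<^esub> \<otimes> 1\<^bsup>\<otimes>(k-a)\<^esup>\<close> are \<open>1\<close> at \<open>I a = i\<close>, \<open>J a = j\<close>, with \<open>I\<close> and \<open>J\<close> equal elsewhere.
\<close>

definition M_op ::
    "('a, 'z) superalgebra_scheme \<Rightarrow> nat \<Rightarrow> nat \<Rightarrow> (nat \<Rightarrow> nat \<Rightarrow> 'a) \<Rightarrow> nat \<Rightarrow> nat \<Rightarrow>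
      (nat \<Rightarrow> nat) \<Rightarrow> (nat \<Rightarrow> nat) \<Rightarrow> 'a" where
  "M_op A m n M k a I J =
    (if I \<in> multi_idx m n k \<and> J \<in> multi_idx m n k \<and> (\<forall>b \<in> {1..k} - {a}. I b = J b)
     then ((- 1) ^ (par m (I a) * par m (J a) + par m (J a))) \<odot>\<^bsub>A\<^esub> M (I a) (J a)
     else \<zero>\<^bsub>A\<^esub>)"

definition right_quantum_element ::
    "('a, 'z) superalgebra_scheme \<Rightarrow> nat \<Rightarrow> nat \<Rightarrow> complex \<Rightarrow> (nat \<Rightarrow> nat \<Rightarrow> 'a) \<Rightarrow>
      (nat \<Rightarrow> nat) \<Rightarrow> (nat \<Rightarrow> nat) \<Rightarrow> 'a" where
  "right_quantum_element A m n q M =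
    (let T = tensor_End A m n 2; P = P_op A m n q 2 1 in
      ordered_prod T
        [\<one>\<^bsub>T\<^esub> \<oplus>\<^bsub>T\<^esub> ((- 1) \<odot>\<^bsub>T\<^esub> P), M_op A m n M 2 1, M_op A m n M 2 2, \<one>\<^bsub>T\<^esub> \<oplus>\<^bsub>T\<^esub> P])"

definition right_quantum_ideal ::
    "nat \<Rightarrow> nat \<Rightarrow> complex \<Rightarrow> ((nat \<times> nat) word \<Rightarrow>\<^sub>0 complex) set" where
  "right_quantum_ideal m n q =
    genideal (free_superalgebra m n)
      {right_quantum_element (free_superalgebra m n) m n q free_gen I J | I J.
        I \<in> multi_idx m n 2 \<and> J \<in> multi_idx m n 2}"

definition right_quantum_superalgebra ::
    "nat \<Rightarrow> nat \<Rightarrow> complex \<Rightarrow> ((nat \<times> nat) word \<Rightarrow>\<^sub>0 complex) set superalgebra" where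
  "right_quantum_superalgebra m n q =
    quotient_superalgebra (free_superalgebra m n) (right_quantum_ideal m n q)"

definition gen ::
    "nat \<Rightarrow> nat \<Rightarrow> complex \<Rightarrow> nat \<Rightarrow> nat \<Rightarrow> ((nat \<times> nat) word \<Rightarrow>\<^sub>0 complex) set" where
  "gen m n q i j = right_quantum_ideal m n q +>\<^bsub>free_superalgebra m n\<^esub> free_gen i j"

end

theory Submission
  imports Defs
begin

text \<open>
  The supertrace \<open>f(\<sigma>) = str P\<^sub>\<sigma>\<^sup>q M\<^sub>1 \<dots> M\<^sub>k\<close> turns the defining relation \<open>(1 - P)M\<^sub>1M\<^sub>2(1 + P) = 0\<close>
  into \<open>f((1 + s)\<sigma>(1 - s)) = 0\<close> for every adjacent transposition \<open>s\<close>, by cyclicity. This alone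
  forces the alternating sums to vanish: let \<open>E\<^sub>r\<close> and \<open>D\<^sub>r\<close> be the sums of \<open>sgn(\<tau>) f(\<sigma>\<tau>)\<close> over
  \<open>\<sigma>\<close> permuting \<open>{1..r}\<close> and \<open>\<tau>\<close> permuting \<open>{r+1..k}\<close>, respectively \<open>{r..k}\<close>. Decomposing the larger
  groups into cosets gives \<open>D\<^sub>r = E\<^sub>r - (k - r)X\<^sub>r\<close> and \<open>D\<^sub>r\<^sub>+\<^sub>1 = E\<^sub>r + r X\<^sub>r\<close> with the same \<open>X\<^sub>r\<close>, so that
  \<open>k E\<^sub>r = r D\<^sub>r + (k - r)D\<^sub>r\<^sub>+\<^sub>1\<close> and the sum telescopes. The second identity is the first one for
  \<open>sgn(\<sigma>) f(\<sigma>\<^sup>-\<^sup>1)\<close>. The signs of the super tensor product are a coboundary on even elements, so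
  all products can be computed as ordinary matrix products over the free algebra.
\<close>


section \<open>Alternating sums over pairs of symmetric groups\<close>

text \<open>The mixed relation absorbs permutations on the far side only. Let H be the sum over the
  permutations of an interval and s an adjacent transposition of it. Summing f((1 + s)zy(1 - s)) = 0
  over the terms z of H gives 2f(Hy) = 2f(Hys), so s is absorbed on the right of y; alternating sums
  absorb on the left of y, with a sign. This is why both coset decompositions lead to the same
  \<open>X\<^sub>r\<close>: every nontrivial representative is the transposition (r, r+1) conjugated
  by a transposition that one of the two sums swallows on both sides. The supertraces lie in a
  noncommutative quotient, so the combinatorics is carried out for complex-valued f, namely for
  supertraces lifted to the free algebra and followed by a linear functional that vanishes on the
  ideal of relations; such functionals detect every element outside the ideal. Two facts about the
  operators remain: \<open>P\<^sub>\<sigma>\<^sup>q\<close> is multiplicative in \<sigma>, which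
  comes from weights of labelled configurations, and the trace is cyclic in these numerical factors,
  which is a change of summation index.\<close>

abbreviation adj :: "nat \<Rightarrow> nat \<Rightarrow> nat" where
  "adj a \<equiv> transpose a (a + 1)"

abbreviation pinv :: "(nat \<Rightarrow> nat) \<Rightarrow> nat \<Rightarrow> nat" where
  "pinv \<equiv> inv_into UNIV"

declare One_nat_def [simp del]

section \<open>Permutations of an interval as words in adjacent transpositions\<close>

lemma word_perm_Nil [simp]: "word_perm [] = id"
  by (simp add: word_perm_def)

lemma word_perm_Cons [simp]: "word_perm (a # w) = adj a \<circ> word_perm w"
  by (simp add: word_perm_def)

lemma word_perm_append: "word_perm (v @ w) = word_perm v \<circ> word_perm w"
  by (induction v) (simp_all add: comp_assoc)

lemma adj_permutes: "b \<le> a \<Longrightarrow> a < c \<Longrightarrow> adj a permutes {b..c}"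
  by (rule permutes_swap_id) auto

lemma word_perm_permutes: "set w \<subseteq> {b..<c} \<Longrightarrow> word_perm w permutes {b..c}"
  by (induction w) (auto intro: permutes_compose adj_permutes simp: permutes_id)

lemma transpose_eq_word_perm:
  "i < j \<Longrightarrow> \<exists>w. set w \<subseteq> {i..<j} \<and> word_perm w = transpose i j"
proof (induction "j - i" arbitrary: j)
  case 0
  then show ?case by simp
next
  case (Suc d)
  then obtain j' where j: "j = j' + 1" by (metis Suc_eq_plus1 less_imp_Suc_add)
  show ?case
  proof (cases "i = j'")
    case True
    then show ?thesis using j by (intro exI[of _ "[i]"]) auto
  next
    case False
    then have ij: "i < j'" using Suc.prems j by auto
    obtain w where w: "set w \<subseteq> {i..<j'}" "word_perm w = transpose i j'"
      using Suc.hyps(1)[of j'] Suc.hyps(2) ij j by force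
    have "transpose i (j' + 1) = adj j' \<circ> transpose i j' \<circ> adj j'"
      using ij by (auto simp: fun_eq_iff transpose_def)
    then have "word_perm (j' # w @ [j']) = transpose i j"
      using w j by (simp add: word_perm_append comp_assoc)
    moreover have "set (j' # w @ [j']) \<subseteq> {i..<j}"
      using w ij j by auto
    ultimately show ?thesis by blast
  qed
qed

lemma permutes_interval_word:
  assumes "\<sigma> permutes {b..c}"
  shows "\<exists>w. set w \<subseteq> {b..<c} \<and> word_perm w = \<sigma>"
  using assms finite_atLeastAtMost
proof (induction rule: permutes_induct)
  case id
  show ?case by (intro exI[of _ "[]"]) simp
next
  case (swap i j p)
  obtain w where w: "set w \<subseteq> {b..<c}" "word_perm w = p" using swap by blast
  have "\<exists>v. set v \<subseteq> {b..<c} \<and> word_perm v = transpose i j"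
  proof (rule linorder_cases[of i j])
    assume "i < j"
    then show ?thesis using transpose_eq_word_perm[of i j] swap(1,2) by force
  next
    assume "i = j"
    then show ?thesis by (intro exI[of _ "[]"]) simp
  next
    assume "j < i"
    then show ?thesis using transpose_eq_word_perm[of j i] swap(1,2)
      by (force simp: transpose_commute)
  qed
  then obtain v where "set v \<subseteq> {b..<c}" "word_perm v = transpose i j" by blast
  with w have "set (v @ w) \<subseteq> {b..<c} \<and> word_perm (v @ w) = transpose i j \<circ> p"
    by (simp add: word_perm_append)
  then show ?case by blast
qed

text \<open>Reduces the absorption lemmas below to one adjacent transposition at a time.\<close>

lemma permutes_interval_induct [consumes 1, case_names id adj]:
  assumes "\<sigma> permutes {b..c}" and "P id"
    and step: "\<And>a p. b \<le> a \<Longrightarrow> a < c \<Longrightarrow> p permutes {b..c} \<Longrightarrow> P p \<Longrightarrow> P (adj a \<circ> p)"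
  shows "P \<sigma>"
proof -
  obtain w where w: "set w \<subseteq> {b..<c}" "word_perm w = \<sigma>"
    using permutes_interval_word[OF assms(1)] by blast
  have "P (word_perm w)"
    using w(1) by (induction w) (auto simp: \<open>P id\<close> intro!: step word_perm_permutes)
  with w show ?thesis by simp
qed

lemma reduced_decomp_exists:
  assumes "\<sigma> permutes {b..c}"
  shows "reduced_decomp b c \<sigma> (SOME w. reduced_decomp b c \<sigma> w)"
proof -
  let ?Q = "\<lambda>w. set w \<subseteq> {b..<c} \<and> word_perm w = \<sigma>"
  obtain w where "?Q w" using permutes_interval_word[OF assms] by blast
  then obtain v where "?Q v" "\<forall>u. ?Q u \<longrightarrow> length v \<le> length u"
    using ex_has_least_nat[of ?Q w length] by blast
  then have "reduced_decomp b c \<sigma> v" unfolding reduced_decomp_def by blast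
  then show ?thesis by (rule someI)
qed

lemma permutation_of_permutes: "\<sigma> permutes {b..c} \<Longrightarrow> permutation \<sigma>" for \<sigma> :: "nat \<Rightarrow> nat"
  using finite_atLeastAtMost by (auto simp: permutation_permutes)

lemma permutes_commute:
  fixes \<sigma> \<tau> :: "nat \<Rightarrow> nat"
  assumes "\<sigma> permutes S" "\<tau> permutes T" "S \<inter> T = {}"
  shows "\<sigma> \<circ> \<tau> = \<tau> \<circ> \<sigma>"
proof
  fix x
  show "(\<sigma> \<circ> \<tau>) x = (\<tau> \<circ> \<sigma>) x"
    using assms permutes_not_in[OF assms(1)] permutes_not_in[OF assms(2)]
      permutes_in_image[OF assms(1)] permutes_in_image[OF assms(2)]
    by (metis comp_apply disjoint_iff)
qed

section \<open>Functions on the symmetric group subject to the mixed relation\<close>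

locale mixed_functional =
  fixes f :: "(nat \<Rightarrow> nat) \<Rightarrow> complex" and k :: nat
  assumes mixed: "\<And>a y. \<lbrakk>y permutes {1..k}; 1 \<le> a; a < k\<rbrakk> \<Longrightarrow>
      f y + f (adj a \<circ> y) = f (y \<circ> adj a) + f (adj a \<circ> y \<circ> adj a)"
begin

text \<open>Left multiplication by \<open>adj a\<close> permutes the summands, so the mixed relation
  at \<open>\<sigma> \<circ> y\<close>, summed over \<open>\<sigma>\<close>, equates twice the sum
  for \<open>y\<close> with twice the sum for \<open>y \<circ> adj a\<close>. The induction moves
  the first letter of \<open>t\<close> into \<open>y\<close>, so \<open>y\<close> has to be
  arbitrary.\<close>

lemma sym_absorb:
  assumes "t permutes {b..c}" "1 \<le> b" "c \<le> k" "y permutes {1..k}"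
  shows "(\<Sum>\<sigma> | \<sigma> permutes {b..c}. f (\<sigma> \<circ> y \<circ> t)) = (\<Sum>\<sigma> | \<sigma> permutes {b..c}. f (\<sigma> \<circ> y))"
  using assms(1,4)
proof (induction t arbitrary: y rule: permutes_interval_induct)
  case id
  then show ?case by simp
next
  case (adj a p)
  have sub: "{b..c} \<subseteq> {1..k}" using assms by auto
  have a: "1 \<le> a" "a < k" using adj assms by auto
  have ap: "adj a permutes {b..c}" using adj by (intro adj_permutes)
  have left: "(\<Sum>\<sigma> | \<sigma> permutes {b..c}. f (adj a \<circ> \<sigma> \<circ> z)) = (\<Sum>\<sigma> | \<sigma> permutes {b..c}. f (\<sigma> \<circ> z))" for z
    by (rule setum_permutations_compose_left[OF ap, symmetric, of "\<lambda>\<sigma>. f (\<sigma> \<circ> z)"])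
  have "(\<Sum>\<sigma> | \<sigma> permutes {b..c}. f (\<sigma> \<circ> y) + f (adj a \<circ> (\<sigma> \<circ> y)))
      = (\<Sum>\<sigma> | \<sigma> permutes {b..c}. f (\<sigma> \<circ> y \<circ> adj a) + f (adj a \<circ> (\<sigma> \<circ> y) \<circ> adj a))"
    by (intro sum.cong refl mixed a) (auto intro: permutes_compose permutes_subset[OF _ sub] adj)
  then have "2 * (\<Sum>\<sigma> | \<sigma> permutes {b..c}. f (\<sigma> \<circ> y))
      = 2 * (\<Sum>\<sigma> | \<sigma> permutes {b..c}. f (\<sigma> \<circ> (y \<circ> adj a)))"
    using left[of y] left[of "y \<circ> adj a"] by (simp add: sum.distrib comp_assoc)
  then have "(\<Sum>\<sigma> | \<sigma> permutes {b..c}. f (\<sigma> \<circ> (y \<circ> adj a))) = (\<Sum>\<sigma> | \<sigma> permutes {b..c}. f (\<sigma> \<circ> y))"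
    by simp
  moreover have "(\<Sum>\<sigma> | \<sigma> permutes {b..c}. f (\<sigma> \<circ> (y \<circ> adj a) \<circ> p))
      = (\<Sum>\<sigma> | \<sigma> permutes {b..c}. f (\<sigma> \<circ> (y \<circ> adj a)))"
    using a by (intro adj.IH permutes_compose adj.prems adj_permutes) auto
  ultimately show ?case by (simp only: comp_assoc)
qed

text \<open>Mirror image of \<open>sym_absorb\<close>: right multiplication by \<open>adj a\<close>
  negates an alternating sum, so the summed relation says that the sums for \<open>z\<close> and
  \<open>adj a \<circ> z\<close> are opposite. Here the tail \<open>p\<close> of \<open>t\<close> is
  absorbed first, by the induction hypothesis.\<close>

lemma antisym_absorb:
  assumes "t permutes {b..c}" "1 \<le> b" "c \<le> k" "y permutes {1..k}"
  shows "(\<Sum>\<tau> | \<tau> permutes {b..c}. of_int (sign \<tau>) * f (t \<circ> y \<circ> \<tau>)) =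
    of_int (sign t) * (\<Sum>\<tau> | \<tau> permutes {b..c}. of_int (sign \<tau>) * f (y \<circ> \<tau>))"
  using assms(1,4)
proof (induction t arbitrary: y rule: permutes_interval_induct)
  case id
  then show ?case by simp
next
  case (adj a p)
  have sub: "{b..c} \<subseteq> {1..k}" using assms by auto
  have a: "1 \<le> a" "a < k" using adj assms by auto
  have ap: "adj a permutes {b..c}" using adj by (intro adj_permutes)
  let ?S = "\<lambda>g. (\<Sum>\<tau> | \<tau> permutes {b..c}. of_int (sign \<tau>) * f (g \<tau>))"
  have right: "?S (\<lambda>\<tau>. z \<circ> \<tau> \<circ> adj a) = - ?S (\<lambda>\<tau>. z \<circ> \<tau>)" for z
  proof -
    have "?S (\<lambda>\<tau>. z \<circ> \<tau>) = (\<Sum>\<tau> | \<tau> permutes {b..c}. of_int (sign (\<tau> \<circ> adj a)) * f (z \<circ> (\<tau> \<circ> adj a)))"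
      by (rule sum_permutations_compose_right[OF ap])
    also have "\<dots> = (\<Sum>\<tau> | \<tau> permutes {b..c}. - (of_int (sign \<tau>) * f (z \<circ> (\<tau> \<circ> adj a))))"
      using permutation_of_permutes by (intro sum.cong) (auto simp: sign_compose sign_swap_id permutation_swap_id)
    finally show ?thesis by (simp add: sum_negf comp_assoc)
  qed
  define z where "z = p \<circ> y"
  have z: "z permutes {1..k}"
    unfolding z_def using adj permutes_subset[OF _ sub] by (auto intro: permutes_compose)
  have "?S (\<lambda>\<tau>. z \<circ> \<tau>) + ?S (\<lambda>\<tau>. adj a \<circ> z \<circ> \<tau>)
      = (\<Sum>\<tau> | \<tau> permutes {b..c}. of_int (sign \<tau>) * (f (z \<circ> \<tau>) + f (adj a \<circ> (z \<circ> \<tau>))))"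
    by (simp add: sum.distrib distrib_left comp_assoc)
  also have "\<dots> = (\<Sum>\<tau> | \<tau> permutes {b..c}. of_int (sign \<tau>) *
      (f (z \<circ> \<tau> \<circ> adj a) + f (adj a \<circ> (z \<circ> \<tau>) \<circ> adj a)))"
    by (intro sum.cong refl arg_cong2[of _ _ _ _ "(*)"] mixed a)
      (auto intro: permutes_compose permutes_subset[OF _ sub] z)
  also have "\<dots> = ?S (\<lambda>\<tau>. z \<circ> \<tau> \<circ> adj a) + ?S (\<lambda>\<tau>. adj a \<circ> z \<circ> \<tau> \<circ> adj a)"
    by (simp add: sum.distrib distrib_left comp_assoc)
  finally have "2 * (?S (\<lambda>\<tau>. z \<circ> \<tau>) + ?S (\<lambda>\<tau>. adj a \<circ> z \<circ> \<tau>)) = 0"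
    using right[of z] right[of "adj a \<circ> z"] by (simp add: add.commute)
  then have "?S (\<lambda>\<tau>. z \<circ> \<tau>) + ?S (\<lambda>\<tau>. adj a \<circ> z \<circ> \<tau>) = 0" by (simp only: mult_eq_0_iff) simp
  then have "?S (\<lambda>\<tau>. adj a \<circ> z \<circ> \<tau>) = - ?S (\<lambda>\<tau>. z \<circ> \<tau>)" by (simp add: eq_neg_iff_add_eq_0 add.commute)
  moreover have "sign (adj a \<circ> p) = - sign p"
    using permutation_of_permutes[OF adj(3)] by (simp add: sign_compose sign_swap_id permutation_swap_id)
  ultimately show ?case
    using adj.IH[OF adj.prems] unfolding z_def comp_assoc by (simp only: of_int_minus mult_minus_left)
qed

text \<open>In the notation of the overview, \<open>E\<^sub>r\<close> is
  \<open>hook_sum r (r + 1) id\<close>, \<open>D\<^sub>r\<close> is \<open>hook_sum r r id\<close>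
  and \<open>X\<^sub>r\<close> is \<open>hook_sum r (r + 1) (adj r)\<close>. For
  \<open>r' = r\<close> the two intervals share one point, like the row and the column of a hook
  diagram.\<close>

definition hook_sum :: "nat \<Rightarrow> nat \<Rightarrow> (nat \<Rightarrow> nat) \<Rightarrow> complex" where
  "hook_sum r r' g = (\<Sum>\<sigma> | \<sigma> permutes {1..r}. \<Sum>\<tau> | \<tau> permutes {r'..k}.
      of_int (sign \<tau>) * f (\<sigma> \<circ> g \<circ> \<tau>))"

text \<open>\<open>transpose r b\<close> is \<open>adj r\<close> conjugated by
  \<open>t = transpose (r + 1) b\<close>, which permutes \<open>{r+1..k}\<close>. The left copy of
  \<open>t\<close> commutes past \<open>\<sigma>\<close> and is absorbed by
  \<open>antisym_absorb\<close>, the right copy reindexes the alternating sum, and the two signs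
  cancel.\<close>

lemma hook_antisym:
  assumes "r < b" "b \<le> k" "1 \<le> r"
  shows "hook_sum r (r + 1) (transpose r b) = hook_sum r (r + 1) (adj r)"
proof -
  define t :: "nat \<Rightarrow> nat" where "t = transpose (r + 1) b"
  have t: "t permutes {r+1..k}" unfolding t_def using assms by (intro permutes_swap_id) auto
  have eq: "transpose r b = t \<circ> adj r \<circ> t"
    using assms by (auto simp: t_def fun_eq_iff transpose_def)
  have "(\<Sum>\<tau> | \<tau> permutes {r+1..k}. of_int (sign \<tau>) * f (\<sigma> \<circ> transpose r b \<circ> \<tau>))
      = (\<Sum>\<tau> | \<tau> permutes {r+1..k}. of_int (sign \<tau>) * f (\<sigma> \<circ> adj r \<circ> \<tau>))"
    if s: "\<sigma> permutes {1..r}" for \<sigma>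
  proof -
    have st: "\<sigma> \<circ> t = t \<circ> \<sigma>" by (rule permutes_commute[OF s t]) auto
    have s': "\<sigma> permutes {1..k}" using s permutes_subset assms by fastforce
    have r': "adj r permutes {1..k}" using assms by (intro adj_permutes) auto
    have t': "t permutes {1..k}" using t permutes_subset assms by fastforce
    have "(\<Sum>\<tau> | \<tau> permutes {r+1..k}. of_int (sign \<tau>) * f (\<sigma> \<circ> transpose r b \<circ> \<tau>))
      = (\<Sum>\<tau> | \<tau> permutes {r+1..k}. of_int (sign \<tau>) * f (t \<circ> (\<sigma> \<circ> adj r \<circ> t) \<circ> \<tau>))"
      using st by (simp add: eq comp_assoc[symmetric])
    also have "\<dots> = of_int (sign t) * (\<Sum>\<tau> | \<tau> permutes {r+1..k}. of_int (sign \<tau>) * f (\<sigma> \<circ> adj r \<circ> t \<circ> \<tau>))"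
      using assms by (intro antisym_absorb t permutes_compose s' t' r') auto
    also have "\<dots> = (\<Sum>\<tau> | \<tau> permutes {r+1..k}. of_int (sign (t \<circ> \<tau>)) * f (\<sigma> \<circ> adj r \<circ> (t \<circ> \<tau>)))"
      unfolding sum_distrib_left
      using permutation_of_permutes t by (intro sum.cong) (auto simp: sign_compose comp_assoc)
    also have "\<dots> = (\<Sum>\<tau> | \<tau> permutes {r+1..k}. of_int (sign \<tau>) * f (\<sigma> \<circ> adj r \<circ> \<tau>))"
      by (rule setum_permutations_compose_left[OF t, symmetric])
    finally show ?thesis .
  qed
  then show ?thesis unfolding hook_sum_def by (rule sum.cong[OF refl]) blast
qed

text \<open>The same conjugation on the symmetric side, with \<open>t = transpose b r\<close>: the
  left copy reindexes the sum over \<open>\<sigma>\<close>, the right copy commutes past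
  \<open>\<tau>\<close> and is absorbed by \<open>sym_absorb\<close>.\<close>

lemma hook_sym:
  assumes "1 \<le> b" "b \<le> r" "r < k"
  shows "hook_sum r (r + 1) (transpose (r + 1) b) = hook_sum r (r + 1) (adj r)"
proof -
  define t :: "nat \<Rightarrow> nat" where "t = transpose b r"
  have t: "t permutes {1..r}" unfolding t_def using assms by (intro permutes_swap_id) auto
  have eq: "transpose (r + 1) b = t \<circ> adj r \<circ> t"
    using assms by (auto simp: t_def fun_eq_iff transpose_def)
  have "(\<Sum>\<sigma> | \<sigma> permutes {1..r}. of_int (sign \<tau>) * f (\<sigma> \<circ> transpose (r + 1) b \<circ> \<tau>))
      = (\<Sum>\<sigma> | \<sigma> permutes {1..r}. of_int (sign \<tau>) * f (\<sigma> \<circ> adj r \<circ> \<tau>))"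
    if s: "\<tau> permutes {r+1..k}" for \<tau>
  proof -
    have st: "t \<circ> \<tau> = \<tau> \<circ> t" by (rule permutes_commute[OF t s]) auto
    have s': "\<tau> permutes {1..k}" using s permutes_subset assms by fastforce
    have r': "adj r permutes {1..k}" using assms by (intro adj_permutes) auto
    have "(\<Sum>\<sigma> | \<sigma> permutes {1..r}. f (\<sigma> \<circ> transpose (r + 1) b \<circ> \<tau>))
      = (\<Sum>\<sigma> | \<sigma> permutes {1..r}. f ((\<sigma> \<circ> t) \<circ> (adj r \<circ> \<tau> \<circ> t)))"
      using st by (simp add: eq comp_assoc)
    also have "\<dots> = (\<Sum>\<sigma> | \<sigma> permutes {1..r}. f (\<sigma> \<circ> (adj r \<circ> \<tau> \<circ> t)))"
      by (rule sum_permutations_compose_right[OF t, symmetric])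
    also have "\<dots> = (\<Sum>\<sigma> | \<sigma> permutes {1..r}. f (\<sigma> \<circ> (adj r \<circ> \<tau>)))"
      using sym_absorb[OF t _ _ permutes_compose[OF s' r']] assms by (simp add: comp_assoc)
    finally show ?thesis by (simp add: sum_distrib_left[symmetric] comp_assoc)
  qed
  then show ?thesis unfolding hook_sum_def
    by (subst (1 2) sum.swap, rule sum.cong[OF refl]) blast
qed

text \<open>The transpositions \<open>transpose r b\<close> represent the cosets of the permutations
  of \<open>{r+1..k}\<close> in those of \<open>{r..k}\<close>. All but the one with
  \<open>b = r\<close> are odd, whence the minus sign, and each contributes \<open>X\<^sub>r\<close>
  by \<open>hook_antisym\<close>.\<close>

lemma hook_lower:
  assumes "1 \<le> r" "r \<le> k"
  shows "hook_sum r r id = hook_sum r (r + 1) id - of_nat (k - r) * hook_sum r (r + 1) (adj r)"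
proof -
  let ?A = "{r+1..k}"
  have ins: "{r..k} = insert r ?A" using assms by auto
  have "(\<Sum>\<tau> | \<tau> permutes {r..k}. of_int (sign \<tau>) * f (\<sigma> \<circ> id \<circ> \<tau>))
    = (\<Sum>\<tau> | \<tau> permutes ?A. of_int (sign \<tau>) * f (\<sigma> \<circ> id \<circ> \<tau>))
      - (\<Sum>b\<in>?A. \<Sum>\<tau> | \<tau> permutes ?A. of_int (sign \<tau>) * f (\<sigma> \<circ> transpose r b \<circ> \<tau>))" for \<sigma>
  proof -
    have "(\<Sum>\<tau> | \<tau> permutes {r..k}. of_int (sign \<tau>) * f (\<sigma> \<circ> id \<circ> \<tau>))
      = (\<Sum>b\<in>insert r ?A. \<Sum>\<tau> | \<tau> permutes ?A.
          of_int (sign (transpose r b \<circ> \<tau>)) * f (\<sigma> \<circ> id \<circ> (transpose r b \<circ> \<tau>)))"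
      unfolding ins by (rule sum_over_permutations_insert) auto
    also have "\<dots> = (\<Sum>\<tau> | \<tau> permutes ?A. of_int (sign \<tau>) * f (\<sigma> \<circ> id \<circ> \<tau>)) +
        (\<Sum>b\<in>?A. \<Sum>\<tau> | \<tau> permutes ?A.
          of_int (sign (transpose r b \<circ> \<tau>)) * f (\<sigma> \<circ> id \<circ> (transpose r b \<circ> \<tau>)))"
      by (subst sum.insert) auto
    also have "(\<Sum>b\<in>?A. \<Sum>\<tau> | \<tau> permutes ?A.
          of_int (sign (transpose r b \<circ> \<tau>)) * f (\<sigma> \<circ> id \<circ> (transpose r b \<circ> \<tau>)))
       = (\<Sum>b\<in>?A. \<Sum>\<tau> | \<tau> permutes ?A. - (of_int (sign \<tau>) * f (\<sigma> \<circ> transpose r b \<circ> \<tau>)))"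
      using permutation_of_permutes
      by (intro sum.cong refl) (auto simp: sign_compose sign_swap_id permutation_swap_id comp_assoc)
    finally show ?thesis unfolding sum_negf by (simp only: diff_conv_add_uminus)
  qed
  then have "hook_sum r r id = hook_sum r (r + 1) id - (\<Sum>\<sigma> | \<sigma> permutes {1..r}.
      (\<Sum>b\<in>?A. \<Sum>\<tau> | \<tau> permutes ?A. of_int (sign \<tau>) * f (\<sigma> \<circ> transpose r b \<circ> \<tau>)))"
    unfolding hook_sum_def by (simp only: sum_subtractf)
  also have "(\<Sum>\<sigma> | \<sigma> permutes {1..r}.
      (\<Sum>b\<in>?A. \<Sum>\<tau> | \<tau> permutes ?A. of_int (sign \<tau>) * f (\<sigma> \<circ> transpose r b \<circ> \<tau>)))
      = (\<Sum>b\<in>?A. hook_sum r (r + 1) (transpose r b))"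
    unfolding hook_sum_def by (rule sum.swap)
  also have "\<dots> = (\<Sum>b\<in>?A. hook_sum r (r + 1) (adj r))"
    using assms by (intro sum.cong refl hook_antisym) auto
  also have "\<dots> = of_nat (k - r) * hook_sum r (r + 1) (adj r)"
    by simp
  finally show ?thesis .
qed

text \<open>Now the symmetric side is decomposed, with representatives
  \<open>transpose (r + 1) b\<close> to the right of \<open>\<sigma>\<close>, in the place of the
  middle factor \<open>g\<close>. No sign arises, so the \<open>r\<close> nontrivial cosets add
  up.\<close>

lemma hook_upper:
  assumes "r < k"
  shows "hook_sum (r + 1) (r + 1) id = hook_sum r (r + 1) id + of_nat r * hook_sum r (r + 1) (adj r)"
proof -
  let ?A = "{1..r}"
  have ins: "{1..r+1} = insert (r + 1) ?A" using assms by auto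
  \<comment> \<open>\<open>sum_over_permutations_insert\<close> puts the transposition on the left;
    summing over inverses moves it to the right.\<close>
  have inv_comp: "pinv (transpose (r + 1) b \<circ> pinv \<sigma>) = \<sigma> \<circ> transpose (r + 1) b"
    if "\<sigma> permutes ?A" for \<sigma> b
    using permutes_bij[OF permutes_inv[OF that]] that by (subst o_inv_distrib) (auto simp: permutes_inv_inv)
  have "(\<Sum>\<sigma> | \<sigma> permutes {1..r+1}. F \<sigma>)
      = (\<Sum>b\<in>insert (r + 1) ?A. \<Sum>\<sigma> | \<sigma> permutes ?A. F (\<sigma> \<circ> transpose (r + 1) b))" for F :: "_ \<Rightarrow> complex"
  proof -
    have "(\<Sum>\<sigma> | \<sigma> permutes {1..r+1}. F \<sigma>) = (\<Sum>\<sigma> | \<sigma> permutes {1..r+1}. F (pinv \<sigma>))"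
      by (rule sum_permutations_inverse)
    also have "\<dots> = (\<Sum>b\<in>insert (r + 1) ?A. \<Sum>\<sigma> | \<sigma> permutes ?A. F (pinv (transpose (r + 1) b \<circ> \<sigma>)))"
      unfolding ins by (rule sum_over_permutations_insert) auto
    also have "\<dots> = (\<Sum>b\<in>insert (r + 1) ?A. \<Sum>\<sigma> | \<sigma> permutes ?A. F (pinv (transpose (r + 1) b \<circ> pinv \<sigma>)))"
      by (intro sum.cong refl sum_permutations_inverse)
    finally show ?thesis using inv_comp by simp
  qed
  then have "hook_sum (r + 1) (r + 1) id = (\<Sum>b\<in>insert (r + 1) ?A. hook_sum r (r + 1) (transpose (r + 1) b))"
    unfolding hook_sum_def by simp
  also have "\<dots> = hook_sum r (r + 1) id + (\<Sum>b\<in>?A. hook_sum r (r + 1) (transpose (r + 1) b))"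
    by (subst sum.insert) auto
  also have "(\<Sum>b\<in>?A. hook_sum r (r + 1) (transpose (r + 1) b)) = (\<Sum>b\<in>?A. hook_sum r (r + 1) (adj r))"
    using assms by (intro sum.cong refl hook_sym) auto
  also have "\<dots> = of_nat r * hook_sum r (r + 1) (adj r)"
    by simp
  finally show ?thesis .
qed

lemma alternating_hook_sum:
  assumes "1 \<le> k"
  shows "(\<Sum>r = 0..k. (- 1) ^ r * (1 / fact r) * (1 / fact (k - r)) * hook_sum r (r + 1) id) = 0"
proof -
  \<comment> \<open>\<open>D\<^sub>r\<close> divided by \<open>(r - 1)! (k - r)!\<close>: dividing
    \<open>k E\<^sub>r = r D\<^sub>r + (k - r) D\<^sub>r\<^sub>+\<^sub>1\<close> by
    \<open>r! (k - r)!\<close> leaves \<open>c r + c (r + 1)\<close> on the right. The value 0 at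
    \<open>r = 0\<close> and beyond \<open>k\<close> matches the vanishing factors \<open>r\<close>
    and \<open>k - r\<close> at the two ends.\<close>
  define c where "c r = (if r = 0 \<or> r > k then 0 else hook_sum r r id / (fact (r - 1) * fact (k - r)))" for r
  have step: "of_nat k * ((1 / fact r) * (1 / fact (k - r)) * hook_sum r (r + 1) id) = c r + c (r + 1)"
    if "r \<le> k" for r
  proof -
    have fr: "fact r = of_nat r * (fact (r - 1) :: complex)" if "r \<noteq> 0"
      using that fact_reduce[of r] by simp
    have fk: "fact (k - r) = of_nat (k - r) * (fact (k - (r + 1)) :: complex)" if "r < k"
      using that fact_reduce[of "k - r"] by (simp del: of_nat_diff)
    have 1: "c r = of_nat r * (1 / fact r) * (1 / fact (k - r)) *
        (hook_sum r (r + 1) id - of_nat (k - r) * hook_sum r (r + 1) (adj r))"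
      using hook_lower[of r] that fr by (auto simp: c_def)
    have 2: "c (r + 1) = of_nat (k - r) * (1 / fact r) * (1 / fact (k - r)) *
        (hook_sum r (r + 1) id + of_nat r * hook_sum r (r + 1) (adj r))"
    proof (cases "r < k")
      case True
      then show ?thesis using hook_upper[of r] fk by (auto simp: c_def)
    next
      case False
      then show ?thesis using that by (simp add: c_def)
    qed
    have kk: "(of_nat k :: complex) = of_nat r + of_nat (k - r)"
      using that by (simp add: of_nat_diff)
    show ?thesis unfolding 1 2 kk by (simp add: algebra_simps del: of_nat_diff flip: add_divide_distrib)
  qed
  have tele: "(\<Sum>r = 0..j. (- 1) ^ r * (c r + c (r + 1))) = c 0 + (- 1) ^ j * c (j + 1)" for j
    unfolding Suc_eq_plus1[symmetric] by (induction j) (auto simp: algebra_simps)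
  have "of_nat k * (\<Sum>r = 0..k. (- 1) ^ r * (1 / fact r) * (1 / fact (k - r)) * hook_sum r (r + 1) id)
      = (\<Sum>r = 0..k. (- 1) ^ r * (c r + c (r + 1)))"
    unfolding sum_distrib_left
    by (intro sum.cong refl) (simp flip: step add: algebra_simps)
  also have "\<dots> = 0" unfolding tele by (simp add: c_def)
  finally show ?thesis using assms by simp
qed

text \<open>Sending a permutation to its sign times its inverse is an anti-automorphism of the group
  algebra that exchanges 1 + s and 1 - s, so it preserves the shape (1 + s)y(1 - s).\<close>

lemma mixed_functional_dual: "mixed_functional (\<lambda>\<sigma>. of_int (sign \<sigma>) * f (pinv \<sigma>)) k"
proof
  fix a and y :: "nat \<Rightarrow> nat" assume y: "y permutes {1..k}" and a: "1 \<le> a" "a < k"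
  have s: "adj a permutes {1..k}" using a by (intro adj_permutes) auto
  have sg: "sign (adj a \<circ> y) = - sign y" "sign (y \<circ> adj a) = - sign y" "sign (adj a \<circ> y \<circ> adj a) = sign y"
    using permutation_of_permutes[OF y] permutation_of_permutes[OF s]
    by (simp_all add: sign_compose permutation_compose sign_swap_id)
  have iv: "pinv (adj a \<circ> y) = pinv y \<circ> adj a" "pinv (y \<circ> adj a) = adj a \<circ> pinv y"
     "pinv (adj a \<circ> y \<circ> adj a) = adj a \<circ> pinv y \<circ> adj a"
    using permutes_bij[OF y] permutes_bij[OF s] by (simp_all add: o_inv_distrib bij_comp comp_assoc)
  show "of_int (sign y) * f (pinv y) + of_int (sign (adj a \<circ> y)) * f (pinv (adj a \<circ> y)) =
    of_int (sign (y \<circ> adj a)) * f (pinv (y \<circ> adj a)) +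
    of_int (sign (adj a \<circ> y \<circ> adj a)) * f (pinv (adj a \<circ> y \<circ> adj a))"
    using arg_cong[OF mixed[OF permutes_inv[OF y] a], of "\<lambda>z. of_int (sign y) * z"]
    unfolding sg iv by (simp add: algebra_simps)
qed

lemma alternating_sym_antisym:
  assumes "1 \<le> k"
  shows "(\<Sum>r = 0..k. (- 1) ^ r * (1 / fact r) * (1 / fact (k - r)) *
    (\<Sum>\<sigma> | \<sigma> permutes {1..r}. \<Sum>\<tau> | \<tau> permutes {r+1..k}. of_int (sign \<tau>) * f (\<sigma> \<circ> \<tau>))) = 0"
  using alternating_hook_sum[OF assms] by (simp add: hook_sum_def del: comp_apply)

text \<open>This is \<open>alternating_sym_antisym\<close> for the dual functional:
  \<open>\<sigma>\<close> and \<open>\<tau>\<close> commute, so inverting their product inverts each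
  factor in place, and the sign of \<open>\<tau>\<close> times the sign of
  \<open>\<sigma> \<circ> \<tau>\<close> is the sign of \<open>\<sigma>\<close>.\<close>

lemma alternating_antisym_sym:
  assumes "1 \<le> k"
  shows "(\<Sum>r = 0..k. (- 1) ^ r * (1 / fact r) * (1 / fact (k - r)) *
    (\<Sum>\<sigma> | \<sigma> permutes {1..r}. \<Sum>\<tau> | \<tau> permutes {r+1..k}. of_int (sign \<sigma>) * f (\<sigma> \<circ> \<tau>))) = 0"
proof -
  have "(\<Sum>\<sigma> | \<sigma> permutes {1..r}. \<Sum>\<tau> | \<tau> permutes {r+1..k}. of_int (sign \<sigma>) * f (\<sigma> \<circ> \<tau>))
     = (\<Sum>\<sigma> | \<sigma> permutes {1..r}. \<Sum>\<tau> | \<tau> permutes {r+1..k}.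
         of_int (sign \<tau>) * (of_int (sign (\<sigma> \<circ> \<tau>)) * f (pinv (\<sigma> \<circ> \<tau>))))" for r
  proof -
    have "(\<Sum>\<sigma> | \<sigma> permutes {1..r}. \<Sum>\<tau> | \<tau> permutes {r+1..k}. of_int (sign \<sigma>) * f (\<sigma> \<circ> \<tau>))
       = (\<Sum>\<sigma> | \<sigma> permutes {1..r}. \<Sum>\<tau> | \<tau> permutes {r+1..k}. of_int (sign (pinv \<sigma>)) * f (pinv \<sigma> \<circ> pinv \<tau>))"
      by (subst sum_permutations_inverse) (rule sum.cong[OF refl], rule sum_permutations_inverse)
    also have "\<dots> = (\<Sum>\<sigma> | \<sigma> permutes {1..r}. \<Sum>\<tau> | \<tau> permutes {r+1..k}.
         of_int (sign \<tau>) * (of_int (sign (\<sigma> \<circ> \<tau>)) * f (pinv (\<sigma> \<circ> \<tau>))))"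
    proof (intro sum.cong refl, clarsimp)
      fix \<sigma> \<tau> :: "nat \<Rightarrow> nat" assume st: "\<sigma> permutes {1..r}" "\<tau> permutes {r+1..k}"
      have c: "\<sigma> \<circ> \<tau> = \<tau> \<circ> \<sigma>" using st by (intro permutes_commute[OF st]) auto
      have "pinv (\<sigma> \<circ> \<tau>) = pinv \<sigma> \<circ> pinv \<tau>"
        unfolding c using permutes_bij[OF st(1)] permutes_bij[OF st(2)] by (simp add: o_inv_distrib)
      moreover have "sign (pinv \<sigma>) = sign \<sigma>"
        using permutation_of_permutes[OF st(1)] by (rule sign_inverse)
      moreover have "sign (\<sigma> \<circ> \<tau>) = sign \<sigma> * sign \<tau>"
        using permutation_of_permutes[OF st(1)] permutation_of_permutes[OF st(2)] by (rule sign_compose)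
      ultimately show "of_int (sign (pinv \<sigma>)) * f (pinv \<sigma> \<circ> pinv \<tau>) =
         of_int (sign \<tau>) * (of_int (sign (\<sigma> \<circ> \<tau>)) * f (pinv (\<sigma> \<circ> \<tau>)))"
        by (simp add: mult.left_commute flip: of_int_mult mult.assoc)
    qed
    finally show ?thesis .
  qed
  then show ?thesis
    using mixed_functional.alternating_sym_antisym[OF mixed_functional_dual assms] by simp
qed

end

section \<open>Coefficients of products of the operators P^q\<close>

text \<open>The coefficient of \<open>P\<^sup>q\<close> after rescaling by \<open>twist\<close> (see
  \<open>twist_adj\<close>). Its sign is symmetric in \<open>i\<close> and \<open>j\<close>:
  exchanging two odd letters costs -1. For nonzero \<open>q\<close> the weights of
  \<open>(i, j)\<close> and \<open>(j, i)\<close> are inverse to each other, which reflects that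
  \<open>P\<^sup>q\<close> squares to 1.\<close>

definition swap_wt :: "nat \<Rightarrow> complex \<Rightarrow> nat \<Rightarrow> nat \<Rightarrow> complex" where
  "swap_wt m q i j = q powi sgn (int i - int j) * (- 1) ^ (par m i * par m j)"

fun word_coef :: "nat \<Rightarrow> complex \<Rightarrow> nat list \<Rightarrow> (nat \<Rightarrow> nat) \<Rightarrow> complex" where
  "word_coef m q [] I = 1"
| "word_coef m q (a # w) I = swap_wt m q (I a) (I (a + 1)) * word_coef m q w (I \<circ> adj a)"

lemma word_coef_append:
  "word_coef m q (v @ w) I = word_coef m q v I * word_coef m q w (I \<circ> word_perm v)"
  by (induction v arbitrary: I) (simp_all add: comp_assoc)

text \<open>
  The coefficient of a product of operators \<open>P\<^sup>q\<close> along a word will be a quotient of two values of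
  \<open>config_wt\<close>, hence depends on the permutation only. The letters carry distinct labels because two
  equal odd letters still contribute a sign when they are exchanged.
\<close>

definition pair_wt :: "nat \<Rightarrow> complex \<Rightarrow> nat \<times> nat \<Rightarrow> nat \<times> nat \<Rightarrow> complex" where
  "pair_wt m q z z' = (if fst z > fst z' then q else 1) *
    (if par m (fst z) = 1 \<and> par m (fst z') = 1 \<and> snd z > snd z' then - 1 else 1)"

definition config_wt :: "nat \<Rightarrow> complex \<Rightarrow> nat \<Rightarrow> (nat \<Rightarrow> nat) \<Rightarrow> (nat \<Rightarrow> nat) \<Rightarrow> complex" where
  "config_wt m q k I v =
    (\<Prod>(a, b) \<in> {(a, b). 1 \<le> a \<and> a < b \<and> b \<le> k}. pair_wt m q (I a, v a) (I b, v b))"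

definition perm_coef :: "nat \<Rightarrow> complex \<Rightarrow> nat \<Rightarrow> (nat \<Rightarrow> nat) \<Rightarrow> (nat \<Rightarrow> nat) \<Rightarrow> complex" where
  "perm_coef m q k I \<sigma> = config_wt m q k I id / config_wt m q k (I \<circ> \<sigma>) \<sigma>"

lemma finite_pairs: "finite {(a, b). 1 \<le> a \<and> a < b \<and> b \<le> (k::nat)}"
  by (rule finite_subset[of _ "{1..k} \<times> {1..k}"]) auto

lemma config_wt_nonzero: "q \<noteq> 0 \<Longrightarrow> config_wt m q k I v \<noteq> 0"
  unfolding config_wt_def pair_wt_def by (auto simp: prod_zero_iff[OF finite_pairs])

lemma par_cases: "par m i = 0 \<or> par m i = 1"
  by (simp add: par_def)

text \<open>For equal letters the power of \<open>q\<close> is trivial, and for equal odd letters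
  the factor -1 has to come from the labels, whose order the exchange reverses; hence
  \<open>u \<noteq> v\<close>.\<close>

lemma pair_wt_swap:
  assumes "q \<noteq> 0" "u \<noteq> v"
  shows "pair_wt m q (i, u) (j, v) = swap_wt m q i j * pair_wt m q (j, v) (i, u)"
  using assms par_cases[of m i] par_cases[of m j]
  by (cases i j rule: linorder_cases) (auto simp: pair_wt_def swap_wt_def power_int_minus)

text \<open>Exchanging neighbours keeps the relative order of every other pair of positions, so only
  the factor of the pair \<open>(a, a + 1)\<close> changes.\<close>

lemma config_wt_adj:
  assumes "q \<noteq> 0" "inj v" "1 \<le> a" "a < k"
  shows "config_wt m q k I v = swap_wt m q (I a) (I (a + 1)) * config_wt m q k (I \<circ> adj a) (v \<circ> adj a)"
proof -
  let ?S = "{(a, b). 1 \<le> a \<and> a < b \<and> b \<le> k}"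
  let ?h = "\<lambda>b c. pair_wt m q (I b, v b) (I c, v c)"
  have S: "?S = insert (a, a + 1) (?S - {(a, a + 1)})" using assms by auto
  have "(\<Prod>(b, c) \<in> ?S - {(a, a + 1)}. ?h (adj a b) (adj a c)) = (\<Prod>(b, c) \<in> ?S - {(a, a + 1)}. ?h b c)"
    by (rule prod.reindex_bij_witness[of _ "\<lambda>(b, c). (adj a b, adj a c)" "\<lambda>(b, c). (adj a b, adj a c)"])
      (use assms in \<open>auto simp: transpose_def split: if_splits\<close>)
  moreover have "config_wt m q k (I \<circ> adj a) (v \<circ> adj a)
      = ?h (a + 1) a * (\<Prod>(b, c) \<in> ?S - {(a, a + 1)}. ?h (adj a b) (adj a c))"
    unfolding config_wt_def by (subst S, subst prod.insert) (use finite_pairs in auto)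
  moreover have "config_wt m q k I v = ?h a (a + 1) * (\<Prod>(b, c) \<in> ?S - {(a, a + 1)}. ?h b c)"
    unfolding config_wt_def by (subst S, subst prod.insert) (use finite_pairs in auto)
  moreover have "?h a (a + 1) = swap_wt m q (I a) (I (a + 1)) * ?h (a + 1) a"
    using assms by (intro pair_wt_swap) (auto simp: inj_eq)
  ultimately show ?thesis by simp
qed

lemma config_wt_word:
  assumes "q \<noteq> 0" "inj v" "set w \<subseteq> {1..<k}"
  shows "config_wt m q k I v = word_coef m q w I * config_wt m q k (I \<circ> word_perm w) (v \<circ> word_perm w)"
  using assms(2,3)
proof (induction w arbitrary: I v)
  case (Cons a w)
  have "config_wt m q k (I \<circ> adj a) (v \<circ> adj a) = word_coef m q w (I \<circ> adj a) *
    config_wt m q k (I \<circ> adj a \<circ> word_perm w) (v \<circ> adj a \<circ> word_perm w)"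
    using Cons.prems(2) by (intro Cons.IH inj_compose[OF Cons.prems(1)] inj_transpose) auto
  then show ?case
    using config_wt_adj[OF assms(1) Cons.prems(1), of a k m I] Cons.prems(2)
    by (simp add: comp_assoc del: comp_apply)
qed simp

text \<open>The weights of the configurations met along the word telescope. The word may be reduced
  or not, so multiplicativity (\<open>perm_coef_compose\<close>) follows by concatenating
  words.\<close>

lemma word_coef_eq_perm_coef:
  assumes "q \<noteq> 0" "set w \<subseteq> {1..<k}"
  shows "word_coef m q w I = perm_coef m q k I (word_perm w)"
  using config_wt_word[OF assms(1) inj_on_id assms(2), of m I] config_wt_nonzero[OF assms(1)]
  by (simp add: perm_coef_def)

lemma perm_coef_adj:
  assumes "q \<noteq> 0" "1 \<le> a" "a < k"
  shows "perm_coef m q k I (adj a) = swap_wt m q (I a) (I (a + 1))"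
  using word_coef_eq_perm_coef[OF assms(1), of "[a]" k m I] assms by simp

lemma perm_coef_compose:
  assumes "q \<noteq> 0" "\<sigma> permutes {1..k}" "\<tau> permutes {1..k}"
  shows "perm_coef m q k I (\<sigma> \<circ> \<tau>) = perm_coef m q k I \<sigma> * perm_coef m q k (I \<circ> \<sigma>) \<tau>"
proof -
  obtain v w where "set v \<subseteq> {1..<k}" "word_perm v = \<sigma>" "set w \<subseteq> {1..<k}" "word_perm w = \<tau>"
    using permutes_interval_word assms(2,3) by metis
  then show ?thesis
    using word_coef_append[of m q v w I] word_coef_eq_perm_coef[OF assms(1), of "v @ w" k m I]
      word_coef_eq_perm_coef[OF assms(1), of v k m I] word_coef_eq_perm_coef[OF assms(1), of w k m "I \<circ> \<sigma>"]
    by (simp add: word_perm_append)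
qed


section \<open>The free superalgebra\<close>

type_synonym free_alg = "(nat \<times> nat) word \<Rightarrow>\<^sub>0 complex"

definition sc :: "complex \<Rightarrow> free_alg \<Rightarrow> free_alg" where
  "sc c f = Poly_Mapping.single 0 c * f"

lemma sc_zero [simp]: "sc c 0 = 0" "sc 0 f = 0"
  by (simp_all add: sc_def)

lemma sc_one [simp]: "sc 1 f = f"
  by (simp add: sc_def)

lemma sc_sc [simp]: "sc c (sc d f) = sc (c * d) f"
  by (simp add: sc_def mult_single flip: mult.assoc)

lemma sc_add: "sc c (f + g) = sc c f + sc c g"
  by (simp add: sc_def distrib_left)

lemma sc_add_left: "sc (c + d) f = sc c f + sc d f"
  by (simp add: sc_def single_add distrib_right)

lemma sc_sum: "sc c (sum f S) = (\<Sum>x\<in>S. sc c (f x))"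
  by (simp add: sc_def sum_distrib_left)

lemma sc_mult_left [simp]: "sc c f * g = sc c (f * g)"
  by (simp add: sc_def mult.assoc)

lemma sum_monomials: "f = (\<Sum>w\<in>Poly_Mapping.keys f. Poly_Mapping.single w (Poly_Mapping.lookup f w))"
  by (rule poly_mapping_eqI) (auto simp: lookup_sum lookup_single when_def in_keys_iff)

lemma sc_monomials:
  "sc c f = (\<Sum>w\<in>Poly_Mapping.keys f. Poly_Mapping.single w (c * Poly_Mapping.lookup f w))"
  by (subst (1) sum_monomials[of f]) (simp add: sc_def sum_distrib_left mult_single)

lemma lookup_sc: "Poly_Mapping.lookup (sc c f) w = c * Poly_Mapping.lookup f w"
  unfolding sc_monomials by (auto simp: lookup_sum lookup_single when_def in_keys_iff)

lemma single_0_commute: "f * Poly_Mapping.single 0 c = sc c f" for f :: free_alg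
  unfolding sc_monomials
  by (subst (1) sum_monomials[of f]) (simp add: sum_distrib_right mult_single mult.commute)

lemma sc_mult_right [simp]: "f * sc c g = sc c (f * g)"
proof -
  have "f * sc c g = (f * Poly_Mapping.single 0 c) * g" by (simp add: sc_def mult.assoc)
  then show ?thesis unfolding single_0_commute by simp
qed

lemma sc_minus_one: "sc (- 1) f = - f"
  by (simp add: sc_def single_uminus)

section \<open>Linear functionals on the free algebra\<close>

interpretation sc: vector_space sc
  by unfold_locales (simp_all add: sc_add sc_add_left)

interpretation sc_complex: vector_space_pair sc "(*) :: complex \<Rightarrow> complex \<Rightarrow> complex"
  by unfold_locales (simp_all add: algebra_simps)

text \<open>
  Reduces membership in the ideal of relations to identities between complex numbers.
\<close>

lemma separating_functional:
  assumes "sc.subspace S" "x \<notin> S"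
  obtains l where "Vector_Spaces.linear sc (*) l" "\<And>y. y \<in> S \<Longrightarrow> l y = 0" "l x \<noteq> 0"
proof -
  obtain B where B: "B \<subseteq> S" "sc.independent B" "S \<subseteq> sc.span B"
    using sc.maximal_independent_subset by blast
  have span: "sc.span B = S"
    using B sc.span_minimal[OF B(1) assms(1)] by blast
  then have x: "x \<notin> sc.span B" "x \<notin> B" using assms B(1) by auto
  then have "sc.independent (insert x B)"
    using B(2) sc.independent_insertI by blast
  then obtain l where l: "Vector_Spaces.linear sc (*) l"
      "\<forall>y\<in>insert x B. l y = (if y = x then 1 else 0)"
    using sc_complex.linear_independent_extend[of "insert x B" "\<lambda>y. if y = x then 1 else 0"] by blast
  have "l y = 0" if "y \<in> S" for y
  proof (rule sc_complex.linear_eq_0_on_span[OF l(1)])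
    show "y \<in> sc.span B" using that span by simp
  qed (use l(2) x in auto)
  then show thesis using l that by force
qed

section \<open>Carrier and parity decomposition\<close>

lemma mem_free_carrier:
  "f \<in> free_carrier m n \<longleftrightarrow> (\<forall>w \<in> Poly_Mapping.keys f. set (letters w) \<subseteq> {1..m + n} \<times> {1..m + n})"
  by (simp add: free_carrier_def)

lemma free_carrier_zero [simp, intro]: "0 \<in> free_carrier m n"
  by (simp add: free_carrier_def)

lemma free_carrier_one [simp, intro]: "1 \<in> free_carrier m n"
  by (simp add: free_carrier_def zero_word_def)

lemma free_carrier_add [intro]: "f \<in> free_carrier m n \<Longrightarrow> g \<in> free_carrier m n \<Longrightarrow> f + g \<in> free_carrier m n"
  using keys_add[of f g] unfolding mem_free_carrier by blast

lemma free_carrier_uminus [intro]: "f \<in> free_carrier m n \<Longrightarrow> - f \<in> free_carrier m n"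
  by (simp add: free_carrier_def)

lemma letters_plus [simp]: "letters (u + v) = letters u @ letters v"
  by (simp add: plus_word_def)

lemma letters_zero [simp]: "letters 0 = []"
  by (simp add: zero_word_def)

lemma free_carrier_mult [intro]:
  assumes "f \<in> free_carrier m n" "g \<in> free_carrier m n"
  shows "f * g \<in> free_carrier m n"
  unfolding mem_free_carrier
proof
  fix w assume "w \<in> Poly_Mapping.keys (f * g)"
  then obtain u v where "w = u + v" "u \<in> Poly_Mapping.keys f" "v \<in> Poly_Mapping.keys g"
    using keys_mult[of f g] by blast
  then show "set (letters w) \<subseteq> {1..m + n} \<times> {1..m + n}"
    using assms unfolding mem_free_carrier by auto
qed

lemma keys_sc: "Poly_Mapping.keys (sc c f) \<subseteq> Poly_Mapping.keys f"
  by (auto simp: in_keys_iff lookup_sc)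

lemma free_carrier_sc [intro]: "f \<in> free_carrier m n \<Longrightarrow> sc c f \<in> free_carrier m n"
  using keys_sc unfolding mem_free_carrier by blast

lemma free_carrier_sum [intro]: "(\<And>x. x \<in> S \<Longrightarrow> f x \<in> free_carrier m n) \<Longrightarrow> sum f S \<in> free_carrier m n"
  by (induction S rule: infinite_finite_induct) auto

abbreviation hom_part :: "nat \<Rightarrow> nat \<Rightarrow> nat \<Rightarrow> free_alg set" where
  "hom_part m n p \<equiv> homog (free_superalgebra m n) p"

lemma mem_hom_part:
  "f \<in> hom_part m n p \<longleftrightarrow> f \<in> free_carrier m n \<and> (\<forall>w \<in> Poly_Mapping.keys f. word_par m w = p)"
  by (simp add: free_superalgebra_def)

lemma hom_part_carrier: "f \<in> hom_part m n p \<Longrightarrow> f \<in> free_carrier m n"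
  by (simp add: mem_hom_part)

lemma hom_part_zero [simp, intro]: "0 \<in> hom_part m n p"
  by (simp add: mem_hom_part)

lemma hom_part_one [simp, intro]: "1 \<in> hom_part m n 0"
  by (auto simp add: mem_hom_part word_par_def)

lemma hom_part_add [intro]: "f \<in> hom_part m n p \<Longrightarrow> g \<in> hom_part m n p \<Longrightarrow> f + g \<in> hom_part m n p"
  using keys_add[of f g] unfolding mem_hom_part by (auto intro: free_carrier_add)

lemma hom_part_sc [intro]: "f \<in> hom_part m n p \<Longrightarrow> sc c f \<in> hom_part m n p"
  using keys_sc[of c f] unfolding mem_hom_part by (auto intro: free_carrier_sc)

lemma hom_part_sum [intro]: "(\<And>x. x \<in> S \<Longrightarrow> f x \<in> hom_part m n p) \<Longrightarrow> sum f S \<in> hom_part m n p"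
  by (induction S rule: infinite_finite_induct) auto

lemma word_par_plus: "word_par m (u + v) = (word_par m u + word_par m v) mod 2"
  by (simp add: word_par_def mod_add_eq)

lemma word_par_cases: "word_par m w = 0 \<or> word_par m w = 1"
  by (auto simp add: word_par_def)

lemma hom_part_mult:
  assumes "f \<in> hom_part m n p" "g \<in> hom_part m n p'" "p'' = (p + p') mod 2"
  shows "f * g \<in> hom_part m n p''"
  unfolding mem_hom_part
proof (intro conjI ballI)
  fix w assume "w \<in> Poly_Mapping.keys (f * g)"
  then obtain u v where "w = u + v" "u \<in> Poly_Mapping.keys f" "v \<in> Poly_Mapping.keys g"
    using keys_mult[of f g] by blast
  then show "word_par m w = p''"
    using assms unfolding mem_hom_part by (auto simp: word_par_plus)
qed (use assms in \<open>auto simp: mem_hom_part\<close>)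

lemma hom_part_single:
  "w \<in> {w. set (letters w) \<subseteq> {1..m + n} \<times> {1..m + n} \<and> word_par m w = p} \<Longrightarrow>
    Poly_Mapping.single w c \<in> hom_part m n p"
  by (auto simp: mem_hom_part mem_free_carrier split: if_splits)

text \<open>An explicit projection on monomials that stands in for the definite description in
  \<open>component\<close>.\<close>

definition part :: "nat \<Rightarrow> nat \<Rightarrow> free_alg \<Rightarrow> free_alg" where
  "part m p f = (\<Sum>w | w \<in> Poly_Mapping.keys f \<and> word_par m w = p. Poly_Mapping.single w (Poly_Mapping.lookup f w))"

lemma lookup_part: "Poly_Mapping.lookup (part m p f) w = (if word_par m w = p then Poly_Mapping.lookup f w else 0)"
proof -
  have "Poly_Mapping.lookup (part m p f) w =
     (\<Sum>u | u \<in> Poly_Mapping.keys f \<and> word_par m u = p. if u = w then Poly_Mapping.lookup f w else 0)"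
    unfolding part_def lookup_sum by (intro sum.cong) (auto simp: lookup_single when_def)
  then show ?thesis by (auto simp: in_keys_iff)
qed

lemma part_hom_part: "f \<in> free_carrier m n \<Longrightarrow> part m p f \<in> hom_part m n p"
  unfolding mem_hom_part mem_free_carrier by (auto simp: in_keys_iff lookup_part split: if_splits)

lemma part_decomp: "part m 0 f + part m 1 f = f"
proof (rule poly_mapping_eqI)
  fix w
  show "Poly_Mapping.lookup (part m 0 f + part m 1 f) w = Poly_Mapping.lookup f w"
    using word_par_cases[of m w] by (auto simp: lookup_part lookup_add)
qed

lemma part_add: "part m p (f + g) = part m p f + part m p g"
  by (rule poly_mapping_eqI) (simp add: lookup_part lookup_add)

lemma part_uminus: "part m p (- f) = - part m p f"
  by (rule poly_mapping_eqI) (simp add: lookup_part)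

lemma part_hom: "f \<in> hom_part m n p \<Longrightarrow> part m p' f = (if p = p' then f else 0)"
  by (rule poly_mapping_eqI) (auto simp: lookup_part mem_hom_part in_keys_iff)

lemma part_mult:
  assumes "f \<in> free_carrier m n" "g \<in> free_carrier m n"
  shows "part m 0 (f * g) = part m 0 f * part m 0 g + part m 1 f * part m 1 g"
    and "part m 1 (f * g) = part m 0 f * part m 1 g + part m 1 f * part m 0 g"
proof -
  let ?a = "part m 0 f * part m 0 g + part m 1 f * part m 1 g"
  let ?b = "part m 0 f * part m 1 g + part m 1 f * part m 0 g"
  have fg: "f * g = ?a + ?b"
    by (subst (1) part_decomp[of m f, symmetric], subst (1) part_decomp[of m g, symmetric])
      (simp add: algebra_simps)
  have p: "part m p f \<in> hom_part m n p" "part m p g \<in> hom_part m n p" for p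
    using assms by (auto intro: part_hom_part)
  have a: "?a \<in> hom_part m n 0"
    by (rule hom_part_add; rule hom_part_mult[OF p]) simp_all
  have b: "?b \<in> hom_part m n 1"
    by (rule hom_part_add; rule hom_part_mult[OF p]) simp_all
  show "part m 0 (f * g) = ?a" "part m 1 (f * g) = ?b"
    unfolding fg part_add[of m _ ?a ?b] by (simp_all add: part_hom[OF a] part_hom[OF b])
qed

lemma free_superalgebra_simps:
  "carrier (free_superalgebra m n) = free_carrier m n"
  "mult (free_superalgebra m n) = (*)"
  "one (free_superalgebra m n) = 1"
  "zero (free_superalgebra m n) = 0"
  "add (free_superalgebra m n) = (+)"
  "smult (free_superalgebra m n) = sc"
  by (simp_all add: free_superalgebra_def sc_def fun_eq_iff)

lemma free_ring: "ring (free_superalgebra m n)"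
proof (rule ringI)
  show "abelian_group (free_superalgebra m n)"
    by (rule abelian_groupI)
      (auto simp: free_superalgebra_simps algebra_simps intro: bexI[of _ "- x" for x])
  show "Group.monoid (free_superalgebra m n)"
    by (rule monoidI) (auto simp: free_superalgebra_simps algebra_simps)
qed (auto simp: free_superalgebra_simps algebra_simps)


section \<open>Matrices over the free superalgebra\<close>

text \<open>
  The signs in products of even elements of \<open>A \<otimes> End\<^sup>\<otimes>\<^sup>k\<close> are the coboundary of \<open>(-1)\<close> to the power
  \<open>twist\<close>, so rescaling the coefficients by it yields ordinary matrix multiplication.
\<close>

definition twist :: "nat \<Rightarrow> nat \<Rightarrow> (nat \<Rightarrow> nat) \<Rightarrow> (nat \<Rightarrow> nat) \<Rightarrow> nat" where
  "twist m k I J = (\<Sum>a = 1..k. \<Sum>b = a..k. (par m (I a) + par m (J a)) * par m (J b))"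

lemma minus_one_cong: "even (a + b) \<Longrightarrow> (- 1) ^ a = ((- 1) ^ b :: complex)"
  by (cases "even a"; cases "even b") auto

text \<open>Let u = I + J and v = J + L on the level of parities. The product of the total parities
  is B(u, v) + C(u, v), split into a <= b and b < a; \<open>cross_par\<close> is C(u, v), so B(u, v)
  is left modulo 2. Since v = J + L, bilinearity makes this the coboundary of B(u, J), which is
  \<open>twist\<close>. The factor \<open>unit_par m k J L mod 2\<close> is the parity that the
  right-hand coefficient of an even element has.\<close>

lemma twist_cocycle:
  "(- 1) ^ (unit_par m k I J * (unit_par m k J L mod 2) + cross_par m k I J L) *
    (- 1) ^ twist m k I J * (- 1) ^ twist m k J L = ((- 1) ^ twist m k I L :: complex)"
proof -
  define u where "u a = par m (I a) + par m (J a)" for a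
  define v where "v a = par m (J a) + par m (L a)" for a
  define B where "B f g = (\<Sum>a = 1..k. \<Sum>b = a..k. f a * g b)" for f g :: "nat \<Rightarrow> nat"
  define C where "C f g = (\<Sum>a = 1..k. \<Sum>b = 1..<a. f a * g b)" for f g :: "nat \<Rightarrow> nat"
  have split: "(\<Sum>b = 1..k. f a * g b) = (\<Sum>b = a..k. f a * g b) + (\<Sum>b = 1..<a. f a * g b)"
    if "a \<in> {1..k}" for a and f g :: "nat \<Rightarrow> nat"
    using that by (subst sum.union_disjoint[symmetric]) (auto intro!: sum.cong)
  have prod: "(\<Sum>a = 1..k. f a) * (\<Sum>b = 1..k. g b) = B f g + C f g" for f g :: "nat \<Rightarrow> nat"
    unfolding B_def C_def sum_product by (simp add: split flip: sum.distrib)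
  have add_l: "B (\<lambda>a. f a + f' a) g = B f g + B f' g" for f f' g
    unfolding B_def by (simp add: sum.distrib distrib_right)
  have add_r: "B g (\<lambda>a. f a + f' a) = B g f + B g f'" for f f' g
    unfolding B_def by (simp add: sum.distrib distrib_left)
  have up: "unit_par m k I J * unit_par m k J L = B u v + C u v"
    unfolding unit_par_def prod[symmetric] u_def v_def ..
  have cr: "cross_par m k I J L = C u v"
    unfolding cross_par_def C_def u_def v_def ..
  have tw: "twist m k I J = B u (\<lambda>a. par m (J a))" "twist m k J L = B v (\<lambda>a. par m (L a))"
     "twist m k I L = B (\<lambda>a. par m (I a) + par m (L a)) (\<lambda>a. par m (L a))"
    unfolding twist_def B_def u_def v_def by simp_all
  have "unit_par m k I J * unit_par m k J L + cross_par m k I J L + twist m k I J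
      + twist m k J L + twist m k I L = 2 * (C u v + B u (\<lambda>a. par m (J a)) +
        B (\<lambda>a. par m (I a) + par m (J a) + par m (L a)) (\<lambda>a. par m (L a)))"
    unfolding up cr tw unfolding u_def v_def add_l add_r by simp
  then have "even (unit_par m k I J * unit_par m k J L + cross_par m k I J L + twist m k I J
      + twist m k J L + twist m k I L)"
    by simp
  then have "even (unit_par m k I J * (unit_par m k J L mod 2) + cross_par m k I J L + twist m k I J
      + twist m k J L + twist m k I L)"
    by (simp add: even_add)
  then show ?thesis
    unfolding power_add[symmetric] by (intro minus_one_cong) simp
qed

text \<open>Diagonal coefficients, hence the unit and the supertrace, are unaffected by the
  rescaling.\<close>

lemma twist_refl: "(- 1) ^ twist m k I I = (1 :: complex)"
proof -
  have "twist m k I I = 2 * (\<Sum>a = 1..k. \<Sum>b = a..k. par m (I a) * par m (I b))"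
    unfolding twist_def sum_distrib_left by (simp add: mult_2 distrib_right)
  then show ?thesis by simp
qed

text \<open>In this form every position where \<open>I\<close> and \<open>J\<close> agree
  contributes 1, so only the positions moved by an operator remain.\<close>

lemma minus_one_twist:
  "(- 1) ^ twist m k I J =
    (\<Prod>a = 1..k. (- 1) ^ ((par m (I a) + par m (J a)) * (\<Sum>b = a..k. par m (J b))) :: complex)"
  by (simp add: twist_def power_sum sum_distrib_left)

lemma finite_multi_idx [simp, intro]: "finite (multi_idx m n k)"
  unfolding multi_idx_def by (rule finite_PiE) auto

lemma multi_idx_mem: "I \<in> multi_idx m n k \<Longrightarrow> a \<in> {1..k} \<Longrightarrow> I a \<in> {1..m + n}"
  unfolding multi_idx_def by (rule PiE_mem)

lemma multi_idx_comp:
  assumes "I \<in> multi_idx m n k" "\<sigma> permutes {1..k}"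
  shows "I \<circ> \<sigma> \<in> multi_idx m n k"
  using assms permutes_in_image[OF assms(2)] permutes_not_in[OF assms(2)]
  unfolding multi_idx_def by (auto simp: PiE_iff extensional_def)

lemma unit_par_trans: "(unit_par m k I J + unit_par m k J L) mod 2 = unit_par m k I L mod 2"
proof -
  have "unit_par m k I J + unit_par m k J L = unit_par m k I L + 2 * (\<Sum>a = 1..k. par m (J a))"
    unfolding unit_par_def by (simp add: sum.distrib)
  then show ?thesis by simp
qed

lemma unit_par_comp:
  assumes "\<sigma> permutes {1..k}"
  shows "unit_par m k I (I \<circ> \<sigma>) mod 2 = 0"
proof -
  have "(\<Sum>a = 1..k. par m ((I \<circ> \<sigma>) a)) = (\<Sum>a = 1..k. par m (I a))"
    using sum.permute[OF assms, of "\<lambda>a. par m (I a)"] by (simp add: comp_def)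
  then show ?thesis unfolding unit_par_def by (simp add: sum.distrib flip: mult_2)
qed

type_synonym 'a matr = "(nat \<Rightarrow> nat) \<Rightarrow> (nat \<Rightarrow> nat) \<Rightarrow> 'a"

text \<open>
  Used for the free superalgebra itself, where the defining relations live, and for its quotient
  by them.
\<close>

locale free_image =
  fixes m n :: nat and A :: "('a, 'z) superalgebra_scheme" and \<pi> :: "free_alg \<Rightarrow> 'a"
  assumes monoid_A: "abelian_monoid A"
    and pi_carrier: "f \<in> free_carrier m n \<Longrightarrow> \<pi> f \<in> carrier A"
    and pi_zero: "\<pi> 0 = \<zero>\<^bsub>A\<^esub>"
    and pi_one: "\<pi> 1 = \<one>\<^bsub>A\<^esub>"
    and pi_add: "\<lbrakk>f \<in> free_carrier m n; g \<in> free_carrier m n\<rbrakk> \<Longrightarrow> \<pi> (f + g) = \<pi> f \<oplus>\<^bsub>A\<^esub> \<pi> g"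
    and pi_mult: "\<lbrakk>f \<in> free_carrier m n; g \<in> free_carrier m n\<rbrakk> \<Longrightarrow> \<pi> (f * g) = \<pi> f \<otimes>\<^bsub>A\<^esub> \<pi> g"
    and pi_smult: "f \<in> free_carrier m n \<Longrightarrow> \<pi> (sc c f) = c \<odot>\<^bsub>A\<^esub> \<pi> f"
    and pi_component: "\<lbrakk>p \<in> {0, 1}; p' \<in> {0, 1}; f \<in> hom_part m n p'\<rbrakk> \<Longrightarrow>
      component A p (\<pi> f) = \<pi> (if p = p' then f else 0)"
begin

lemma pi_finsum:
  assumes "finite S" "\<And>x. x \<in> S \<Longrightarrow> f x \<in> free_carrier m n"
  shows "(\<Oplus>\<^bsub>A\<^esub>x\<in>S. \<pi> (f x)) = \<pi> (sum f S)"
proof -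
  interpret abelian_monoid A by (rule monoid_A)
  show ?thesis using assms
  proof (induction S rule: finite_induct)
    case empty
    then show ?case by (simp add: pi_zero)
  next
    case (insert x S)
    then show ?case by (subst finsum_insert) (auto simp: pi_add pi_carrier free_carrier_sum)
  qed
qed

lemma finsum_eq_pi:
  assumes "finite S" "\<And>x. x \<in> S \<Longrightarrow> f x \<in> free_carrier m n" "\<And>x. x \<in> S \<Longrightarrow> g x = \<pi> (f x)"
  shows "(\<Oplus>\<^bsub>A\<^esub>x\<in>S. g x) = \<pi> (sum f S)"
proof -
  interpret abelian_monoid A by (rule monoid_A)
  have "(\<Oplus>\<^bsub>A\<^esub>x\<in>S. g x) = (\<Oplus>\<^bsub>A\<^esub>x\<in>S. \<pi> (f x))"
    using assms by (intro finsum_cong') (auto simp: pi_carrier)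
  then show ?thesis using pi_finsum[OF assms(1,2)] by simp
qed

text \<open>\<open>x\<close> is a lift of \<open>X\<close> to the free algebra with the signs
  removed. The parity condition says that \<open>X\<close> is even, the case covered by
  \<open>twist_cocycle\<close>; the zero value off the index set is the one that the carrier of
  \<open>tensor_End\<close> prescribes.\<close>

definition rep :: "nat \<Rightarrow> free_alg matr \<Rightarrow> 'a matr \<Rightarrow> bool" where
  "rep k x X \<longleftrightarrow>
    (\<forall>I \<in> multi_idx m n k. \<forall>J \<in> multi_idx m n k. x I J \<in> hom_part m n (unit_par m k I J mod 2)) \<and>
    X = (\<lambda>I J. if I \<in> multi_idx m n k \<and> J \<in> multi_idx m n k
      then \<pi> (sc ((- 1) ^ twist m k I J) (x I J)) else \<zero>\<^bsub>A\<^esub>)"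

definition matmul :: "nat \<Rightarrow> free_alg matr \<Rightarrow> free_alg matr \<Rightarrow> free_alg matr" where
  "matmul k x y = (\<lambda>I L. \<Sum>J\<in>multi_idx m n k. x I J * y J L)"

lemma rep_hom:
  "\<lbrakk>rep k x X; I \<in> multi_idx m n k; J \<in> multi_idx m n k\<rbrakk> \<Longrightarrow> x I J \<in> hom_part m n (unit_par m k I J mod 2)"
  by (simp add: rep_def)

lemma rep_entry:
  "\<lbrakk>rep k x X; I \<in> multi_idx m n k; J \<in> multi_idx m n k\<rbrakk> \<Longrightarrow> X I J = \<pi> (sc ((- 1) ^ twist m k I J) (x I J))"
  by (simp add: rep_def)

lemma rep_mult:
  assumes "rep k x X" "rep k y Y"
  shows "rep k (matmul k x y) (X \<otimes>\<^bsub>tensor_End A m n k\<^esub> Y)"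
proof -
  let ?K = "multi_idx m n k"
  have "(\<Oplus>\<^bsub>A\<^esub>J\<in>?K. \<Oplus>\<^bsub>A\<^esub>p\<in>{0, 1}. (- 1) ^ (unit_par m k I J * p + cross_par m k I J L) \<odot>\<^bsub>A\<^esub>
          (X I J \<otimes>\<^bsub>A\<^esub> component A p (Y J L))) =
        \<pi> (sc ((- 1) ^ twist m k I L) (matmul k x y I L))"
    if I: "I \<in> ?K" and L: "L \<in> ?K" for I L
  proof -
    have "(\<Oplus>\<^bsub>A\<^esub>p\<in>{0, 1}. (- 1) ^ (unit_par m k I J * p + cross_par m k I J L) \<odot>\<^bsub>A\<^esub>
          (X I J \<otimes>\<^bsub>A\<^esub> component A p (Y J L))) = \<pi> (sc ((- 1) ^ twist m k I L) (x I J * y J L))"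
      if J: "J \<in> ?K" for J
    proof -
      let ?p = "unit_par m k J L mod 2"
      let ?X = "sc ((- 1) ^ twist m k I J) (x I J)" and ?Y = "sc ((- 1) ^ twist m k J L) (y J L)"
      let ?f = "\<lambda>p. sc ((- 1) ^ (unit_par m k I J * p + cross_par m k I J L)) (?X * (if p = ?p then ?Y else 0))"
      have p: "?p \<in> {0, 1}" by auto
      have X: "?X \<in> free_carrier m n"
        using rep_hom[OF assms(1) I J] hom_part_carrier by blast
      have Y: "?Y \<in> hom_part m n ?p"
        using rep_hom[OF assms(2) J L] by blast
      then have Yc: "(if p = ?p then ?Y else 0) \<in> free_carrier m n" for p
        using hom_part_carrier by auto
      have "(\<Oplus>\<^bsub>A\<^esub>p\<in>{0, 1}. (- 1) ^ (unit_par m k I J * p + cross_par m k I J L) \<odot>\<^bsub>A\<^esub>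
          (X I J \<otimes>\<^bsub>A\<^esub> component A p (Y J L))) = \<pi> (sum ?f {0, 1})"
      proof (rule finsum_eq_pi)
        fix p :: nat assume "p \<in> {0, 1}"
        then have c: "component A p (\<pi> ?Y) = \<pi> (if p = ?p then ?Y else 0)"
          using pi_component[OF _ p Y] by simp
        show "?f p \<in> free_carrier m n"
          using X Yc by blast
        show "(- 1) ^ (unit_par m k I J * p + cross_par m k I J L) \<odot>\<^bsub>A\<^esub> (X I J \<otimes>\<^bsub>A\<^esub> component A p (Y J L)) = \<pi> (?f p)"
          unfolding rep_entry[OF assms(1) I J] rep_entry[OF assms(2) J L] c
          using X Yc by (simp only: pi_mult pi_smult free_carrier_mult)
      qed simp
      \<comment> \<open>By evenness, only the parity of the right-hand coefficient survives in the
        sum over \<open>p\<close>.\<close>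
      also have "sum ?f {0, 1} = ?f ?p"
        using p by (intro sum.mono_neutral_right[of "{0,1}" "{?p}", THEN trans]) auto
      also have "\<dots> = sc ((- 1) ^ (unit_par m k I J * ?p + cross_par m k I J L) *
          (- 1) ^ twist m k I J * (- 1) ^ twist m k J L) (x I J * y J L)"
        by (simp only: sc_mult_left sc_mult_right sc_sc mult.assoc if_True simp_thms
          mult.commute[of "(- 1) ^ twist m k J L :: complex" "(- 1) ^ twist m k I J"])
      finally show ?thesis unfolding twist_cocycle .
    qed
    moreover have "x I J * y J L \<in> free_carrier m n" if "J \<in> ?K" for J
      by (rule free_carrier_mult[OF hom_part_carrier[OF rep_hom[OF assms(1) I that]]
            hom_part_carrier[OF rep_hom[OF assms(2) that L]]])
    ultimately show ?thesis
      unfolding matmul_def sc_sum by (intro finsum_eq_pi finite_multi_idx free_carrier_sc)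
  qed
  moreover have "matmul k x y I L \<in> hom_part m n (unit_par m k I L mod 2)" if "I \<in> ?K" "L \<in> ?K" for I L
    unfolding matmul_def
  proof (rule hom_part_sum)
    fix J assume J: "J \<in> ?K"
    show "x I J * y J L \<in> hom_part m n (unit_par m k I L mod 2)"
      by (rule hom_part_mult[OF rep_hom[OF assms(1) that(1) J] rep_hom[OF assms(2) J that(2)]])
        (simp add: unit_par_trans mod_add_eq)
  qed
  ultimately show ?thesis
    unfolding rep_def tensor_End_def Let_def by (auto simp: fun_eq_iff)
qed

lemma rep_one: "rep k (\<lambda>I J. if I = J then 1 else 0) \<one>\<^bsub>tensor_End A m n k\<^esub>"
proof -
  have "unit_par m k I I mod 2 = 0" for I
    by (simp add: unit_par_def flip: mult_2 sum_distrib_left)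
  then show ?thesis
    unfolding rep_def tensor_End_def Let_def
    by (intro conjI ballI ext) (auto simp: twist_refl pi_one pi_zero)
qed

lemma rep_add:
  assumes "rep k x X" "rep k y Y"
  shows "rep k (\<lambda>I J. x I J + y I J) (X \<oplus>\<^bsub>tensor_End A m n k\<^esub> Y)"
proof -
  have "\<pi> (sc d (x I J)) \<oplus>\<^bsub>A\<^esub> \<pi> (sc d (y I J)) = \<pi> (sc d (x I J + y I J))"
    if "I \<in> multi_idx m n k" "J \<in> multi_idx m n k" for I J d
    using rep_hom[OF assms(1) that, THEN hom_part_carrier] rep_hom[OF assms(2) that, THEN hom_part_carrier]
    by (simp add: sc_add pi_add free_carrier_sc)
  then show ?thesis
    using assms unfolding rep_def tensor_End_def Let_def by (auto simp: fun_eq_iff)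
qed

lemma rep_smult:
  assumes "rep k x X"
  shows "rep k (\<lambda>I J. sc c (x I J)) (c \<odot>\<^bsub>tensor_End A m n k\<^esub> X)"
proof -
  have "c \<odot>\<^bsub>A\<^esub> \<pi> (sc d (x I J)) = \<pi> (sc d (sc c (x I J)))"
    if "I \<in> multi_idx m n k" "J \<in> multi_idx m n k" for I J d
    using rep_hom[OF assms that, THEN hom_part_carrier] pi_smult[of "sc d (x I J)" c]
    by (simp add: mult.commute free_carrier_sc)
  then show ?thesis
    using assms unfolding rep_def tensor_End_def Let_def by (auto simp: fun_eq_iff)
qed

lemma tensor_End_abelian_monoid: "abelian_monoid (tensor_End A m n k)"
proof -
  interpret abelian_monoid A by (rule monoid_A)
  show ?thesis
    by (rule abelian_monoidI; (auto simp: tensor_End_def Let_def fun_eq_iff a_assoc intro: a_comm; metis)?)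
qed

lemma rep_carrier:
  assumes "rep k x X"
  shows "X \<in> carrier (tensor_End A m n k)"
proof -
  have "\<pi> (sc d (x I J)) \<in> carrier A" if "I \<in> multi_idx m n k" "J \<in> multi_idx m n k" for I J d
    using rep_hom[OF assms that, THEN hom_part_carrier] by (simp add: pi_carrier free_carrier_sc)
  then show ?thesis
    using assms unfolding rep_def tensor_End_def Let_def by (auto simp: fun_eq_iff)
qed

lemma rep_zero: "rep k (\<lambda>I J. 0) \<zero>\<^bsub>tensor_End A m n k\<^esub>"
  unfolding rep_def tensor_End_def Let_def by (auto simp: fun_eq_iff pi_zero)

lemma rep_finsum:
  assumes "finite S" "\<And>s. s \<in> S \<Longrightarrow> rep k (x s) (X s)"
  shows "rep k (\<lambda>I J. \<Sum>s\<in>S. x s I J) (\<Oplus>\<^bsub>tensor_End A m n k\<^esub>s\<in>S. X s)"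
proof -
  interpret T: abelian_monoid "tensor_End A m n k" by (rule tensor_End_abelian_monoid)
  show ?thesis using assms
  proof (induction S rule: finite_induct)
    case empty
    then show ?case by (simp add: rep_zero)
  next
    case (insert s S)
    have "rep k (\<lambda>I J. x s I J + (\<Sum>s\<in>S. x s I J)) (X s \<oplus>\<^bsub>tensor_End A m n k\<^esub> (\<Oplus>\<^bsub>tensor_End A m n k\<^esub>s\<in>S. X s))"
      using insert by (intro rep_add) auto
    moreover have "X \<in> S \<rightarrow> carrier (tensor_End A m n k)" "X s \<in> carrier (tensor_End A m n k)"
      using insert.prems rep_carrier by blast+
    ultimately show ?case using insert.hyps by (simp add: T.finsum_insert)
  qed
qed

lemma rep_cong:
  assumes "rep k x X" "\<And>I J. I \<in> multi_idx m n k \<Longrightarrow> J \<in> multi_idx m n k \<Longrightarrow> x I J = y I J"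
  shows "rep k y X"
  using assms unfolding rep_def by (auto simp: fun_eq_iff)

lemma supertrace_rep:
  assumes "rep k x X"
  shows "supertrace A m n k X = \<pi> (\<Sum>I\<in>multi_idx m n k. sc ((- 1) ^ (\<Sum>a = 1..k. par m (I a))) (x I I))"
  unfolding supertrace_def
proof (rule finsum_eq_pi)
  fix I assume I: "I \<in> multi_idx m n k"
  then have c: "x I I \<in> free_carrier m n"
    using rep_hom[OF assms I I] hom_part_carrier by blast
  then show "sc ((- 1) ^ (\<Sum>a = 1..k. par m (I a))) (x I I) \<in> free_carrier m n" by auto
  show "(- 1) ^ (\<Sum>a = 1..k. par m (I a)) \<odot>\<^bsub>A\<^esub> X I I = \<pi> (sc ((- 1) ^ (\<Sum>a = 1..k. par m (I a))) (x I I))"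
    using c by (simp add: rep_entry[OF assms I I] twist_refl pi_smult)
qed simp

end


section \<open>Supertraces of products with symmetrizers\<close>

definition swap_mat :: "nat \<Rightarrow> complex \<Rightarrow> nat \<Rightarrow> free_alg matr" where
  "swap_mat m q a I J = (if J = I \<circ> adj a then sc (swap_wt m q (I a) (I (a + 1))) 1 else 0)"

definition word_mat :: "nat \<Rightarrow> complex \<Rightarrow> nat list \<Rightarrow> free_alg matr" where
  "word_mat m q w I J = (if J = I \<circ> word_perm w then sc (word_coef m q w I) 1 else 0)"

definition perm_mat :: "nat \<Rightarrow> complex \<Rightarrow> nat \<Rightarrow> (nat \<Rightarrow> nat) \<Rightarrow> free_alg matr" where
  "perm_mat m q k \<sigma> I J = (if J = I \<circ> \<sigma> then sc (perm_coef m q k I \<sigma>) 1 else 0)"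

text \<open>The character \<open>\<chi>\<close> is 1 for the q-symmetrizer and the sign for the
  q-antisymmetrizer, so that both identities share one computation.\<close>

definition sym_mat :: "((nat \<Rightarrow> nat) \<Rightarrow> complex) \<Rightarrow> nat \<Rightarrow> complex \<Rightarrow> nat \<Rightarrow> nat \<Rightarrow> nat \<Rightarrow> free_alg matr" where
  "sym_mat \<chi> m q k b c I J =
    sc (1 / fact (card {b..c})) (\<Sum>\<sigma> | \<sigma> permutes {b..c}. sc (\<chi> \<sigma>) (perm_mat m q k \<sigma> I J))"

text \<open>
  In a list of pairs \<open>(i, j)\<close> standing for \<open>M\<^sub>i\<^sub>j\<close>, each \<open>M\<^sub>i\<^sub>j\<close> picks up a sign from the row indices to
  its right. This is what remains of the signs of \<open>M\<^sub>1 \<dots> M\<^sub>k\<close> after untwisting.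
\<close>

fun sign_exp :: "nat \<Rightarrow> (nat \<times> nat) list \<Rightarrow> nat" where
  "sign_exp m [] = 0"
| "sign_exp m (z # zs) =
    (par m (fst z) + par m (snd z)) * (\<Sum>z\<leftarrow>zs. par m (fst z)) + sign_exp m zs"

definition signed_word :: "nat \<Rightarrow> (nat \<times> nat) list \<Rightarrow> free_alg" where
  "signed_word m zs = sc ((- 1) ^ sign_exp m zs) (Poly_Mapping.single (Word zs) 1)"

text \<open>Untwisting replaces the sign in \<open>M_op\<close> by the one for moving
  \<open>M\<^sub>i\<^sub>j\<close> past the indices to the right of \<open>a\<close> (see
  \<open>twist_single\<close>).\<close>

definition M_mat :: "nat \<Rightarrow> nat \<Rightarrow> nat \<Rightarrow> free_alg matr" where
  "M_mat m k a I J = (if \<forall>b \<in> {1..k} - {a}. I b = J b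
     then sc ((- 1) ^ ((par m (I a) + par m (J a)) * (\<Sum>b = a+1..k. par m (J b)))) (free_gen (I a) (J a))
     else 0)"

definition idx_pairs :: "(nat \<Rightarrow> nat) \<Rightarrow> (nat \<Rightarrow> nat) \<Rightarrow> nat \<Rightarrow> nat \<Rightarrow> (nat \<times> nat) list" where
  "idx_pairs I J b k = map (\<lambda>a. (I a, J a)) [b..<k+1]"

text \<open>Closed form of the product \<open>M\<^sub>c \<dots> M\<^sub>k\<close>: the identity in
  the factors before \<open>c\<close>, and one signed word in the remaining ones.\<close>

definition M_tail :: "nat \<Rightarrow> nat \<Rightarrow> nat \<Rightarrow> free_alg matr" where
  "M_tail m k c I J = (if \<forall>b \<in> {1..<c}. I b = J b then signed_word m (idx_pairs I J c k) else 0)"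

lemma multi_idx_eqI:
  assumes "I \<in> multi_idx m n k" "J \<in> multi_idx m n k" "\<And>a. a \<in> {1..k} \<Longrightarrow> I a = J a"
  shows "I = J"
  using assms unfolding multi_idx_def by (metis PiE_ext)

lemma multi_idx_upd:
  assumes "I \<in> multi_idx m n k" "a \<in> {1..k}" "i \<in> {1..m + n}"
  shows "I(a := i) \<in> multi_idx m n k"
  using assms unfolding multi_idx_def by (auto simp: PiE_iff extensional_def)

lemma P_op_support:
  assumes "1 \<le> a" "a < k" "I \<in> multi_idx m n k" "J \<in> multi_idx m n k"
  shows "I a = J (a + 1) \<and> I (a + 1) = J a \<and> (\<forall>b \<in> {1..k} - {a, a + 1}. I b = J b) \<longleftrightarrow> J = I \<circ> adj a"
    (is "?L \<longleftrightarrow> ?R")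
proof
  assume L: ?L
  have "adj a permutes {1..k}" using assms by (intro adj_permutes) auto
  then show ?R
    using assms L by (intro multi_idx_eqI[OF assms(4) multi_idx_comp[OF assms(3)]])
      (auto simp: transpose_def)
next
  assume ?R
  then show ?L by (auto simp: transpose_def)
qed

lemma twist_adj:
  assumes "1 \<le> a" "a < k"
  shows "(- 1) ^ twist m k I (I \<circ> adj a) * swap_wt m q (I a) (I (a + 1)) =
    q powi sgn (int (I a) - int (I (a + 1))) * (- 1) ^ par m (I (a + 1))"
proof -
  let ?J = "I \<circ> adj a"
  let ?t = "\<lambda>c. \<Sum>b = c..k. par m (?J b)"
  let ?f = "\<lambda>c. (- 1) ^ ((par m (I c) + par m (?J c)) * ?t c) :: complex"
  have t: "?t a = par m (I (a + 1)) + ?t (a + 1)"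
    using assms by (subst sum.atLeast_Suc_atMost) (simp_all add: Suc_eq_plus1)
  have "(- 1) ^ twist m k I ?J = prod ?f {a, a + 1}"
    unfolding minus_one_twist using assms
    by (intro prod.mono_neutral_right) (auto simp: transpose_def)
  also have "\<dots> = ?f a * ?f (a + 1)" by simp
  \<comment> \<open>The sum of the column parities from \<open>a + 1\<close> on enters both
    exponents with the same coefficient and cancels modulo 2.\<close>
  also have "\<dots> = (- 1) ^ ((par m (I a) + par m (I (a + 1))) * par m (I (a + 1)))"
    unfolding power_add[symmetric] t by (intro minus_one_cong) (auto simp: algebra_simps)
  finally show ?thesis
    unfolding swap_wt_def by (cases "I a \<le> m"; cases "I (a + 1) \<le> m") (auto simp: par_def)
qed

lemma twist_single:
  assumes "1 \<le> a" "a \<le> k" "\<forall>b \<in> {1..k} - {a}. I b = J b"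
  shows "(- 1) ^ twist m k I J * (- 1) ^ ((par m (I a) + par m (J a)) * (\<Sum>b = a+1..k. par m (J b)))
    = ((- 1) ^ (par m (I a) * par m (J a) + par m (J a)) :: complex)"
proof -
  let ?t = "\<lambda>c. \<Sum>b = c..k. par m (J b)"
  let ?f = "\<lambda>c. (- 1) ^ ((par m (I c) + par m (J c)) * ?t c) :: complex"
  have t: "?t a = par m (J a) + ?t (a + 1)"
    using assms by (subst sum.atLeast_Suc_atMost) (simp_all add: Suc_eq_plus1)
  have "(- 1) ^ twist m k I J = prod ?f {a}"
    unfolding minus_one_twist using assms
    by (intro prod.mono_neutral_right) (auto simp flip: mult_2)
  also have "\<dots> = ?f a" by simp
  finally show ?thesis
    unfolding t by (simp only: power_add[symmetric]) (intro minus_one_cong, auto simp: algebra_simps)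
qed

lemma unit_par_single:
  assumes "1 \<le> a" "a \<le> k" "\<forall>b \<in> {1..k} - {a}. I b = J b"
  shows "unit_par m k I J mod 2 = (par m (I a) + par m (J a)) mod 2"
proof -
  have "unit_par m k I J = (par m (I a) + par m (J a)) + (\<Sum>b\<in>{1..k} - {a}. par m (I b) + par m (J b))"
    unfolding unit_par_def using assms by (subst sum.remove[of _ a]) auto
  also have "(\<Sum>b\<in>{1..k} - {a}. par m (I b) + par m (J b)) = 2 * (\<Sum>b\<in>{1..k} - {a}. par m (I b))"
    unfolding sum_distrib_left using assms by (intro sum.cong) auto
  finally show ?thesis by simp
qed

lemma ordered_prod_Nil [simp]: "ordered_prod G [] = \<one>\<^bsub>G\<^esub>"
  by (simp add: ordered_prod_def)

lemma ordered_prod_Cons [simp]: "ordered_prod G (x # xs) = x \<otimes>\<^bsub>G\<^esub> ordered_prod G xs"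
  by (simp add: ordered_prod_def)

section \<open>Untwisted matrices of the operators\<close>

context free_image
begin

lemma rep_P_op:
  assumes "1 \<le> a" "a < k"
  shows "rep k (swap_mat m q a) (P_op A m n q k a)"
proof -
  have ad: "adj a permutes {1..k}" using assms by (intro adj_permutes) auto
  have "P_op A m n q k a I J = \<pi> (sc ((- 1) ^ twist m k I J) (swap_mat m q a I J))"
    if "I \<in> multi_idx m n k" "J \<in> multi_idx m n k" for I J
    using that P_op_support[OF assms that] twist_adj[OF assms, of m I q]
    by (auto simp: P_op_def swap_mat_def pi_zero pi_one pi_smult)
  moreover have "swap_mat m q a I J \<in> hom_part m n (unit_par m k I J mod 2)" for I J
    using unit_par_comp[OF ad, of m I] by (auto simp: swap_mat_def simp del: comp_apply)
  ultimately show ?thesis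
    unfolding rep_def by (auto simp: fun_eq_iff P_op_def)
qed

lemma matmul_swap:
  assumes "1 \<le> a" "a < k" "I \<in> multi_idx m n k"
  shows "matmul k (swap_mat m q a) x I L = sc (swap_wt m q (I a) (I (a + 1))) (x (I \<circ> adj a) L)"
proof -
  have "I \<circ> adj a \<in> multi_idx m n k"
    using assms by (intro multi_idx_comp adj_permutes) auto
  then show ?thesis
    unfolding matmul_def swap_mat_def by (simp add: if_distrib[of "\<lambda>z. z * _"] cong: if_cong)
qed

lemma rep_P_word:
  assumes "set w \<subseteq> {1..<k}"
  shows "rep k (word_mat m q w) (ordered_prod (tensor_End A m n k) (map (P_op A m n q k) w))"
  using assms
proof (induction w)
  case Nil
  then show ?case using rep_one[of k] by (auto simp: word_mat_def elim!: rep_cong)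
next
  case (Cons a w)
  then have a: "1 \<le> a" "a < k" by auto
  have "rep k (matmul k (swap_mat m q a) (word_mat m q w))
      (ordered_prod (tensor_End A m n k) (map (P_op A m n q k) (a # w)))"
    using Cons by (auto intro!: rep_mult rep_P_op)
  then show ?case
    by (rule rep_cong) (simp add: matmul_swap[OF a] word_mat_def comp_assoc del: comp_apply)
qed

lemma rep_P_perm:
  assumes "q \<noteq> 0" "\<sigma> permutes {b..c}" "1 \<le> b" "c \<le> k"
  shows "rep k (perm_mat m q k \<sigma>) (P_perm A m n q k b c \<sigma>)"
proof -
  define w where "w = (SOME w. reduced_decomp b c \<sigma> w)"
  have w: "set w \<subseteq> {b..<c}" "word_perm w = \<sigma>"
    using reduced_decomp_exists[OF assms(2), folded w_def] by (simp_all add: reduced_decomp_def)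
  then have wk: "set w \<subseteq> {1..<k}" using assms by force
  have "word_mat m q w = perm_mat m q k \<sigma>"
    unfolding word_mat_def perm_mat_def word_coef_eq_perm_coef[OF assms(1) wk] w(2)
    by (simp add: fun_eq_iff)
  then show ?thesis
    using rep_P_word[OF wk, of q] unfolding P_perm_def w_def[symmetric] by simp
qed

lemma rep_q_sym:
  assumes "q \<noteq> 0" "1 \<le> b" "c \<le> k"
  shows "rep k (sym_mat (\<lambda>_. 1) m q k b c) (q_sym A m n q k b c)"
proof -
  have "rep k (\<lambda>I J. sc (1 / fact (card {b..c})) (\<Sum>\<sigma> | \<sigma> permutes {b..c}. perm_mat m q k \<sigma> I J)) (q_sym A m n q k b c)"
    unfolding q_sym_def
    by (intro rep_smult rep_finsum rep_P_perm) (use assms in \<open>auto simp: finite_permutations\<close>)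
  then show ?thesis by (rule rep_cong) (simp add: sym_mat_def)
qed

lemma rep_q_antisym:
  assumes "q \<noteq> 0" "1 \<le> b" "c \<le> k"
  shows "rep k (sym_mat (\<lambda>\<sigma>. of_int (sign \<sigma>)) m q k b c) (q_antisym A m n q k b c)"
proof -
  have "rep k (\<lambda>I J. sc (1 / fact (card {b..c})) (\<Sum>\<sigma> | \<sigma> permutes {b..c}. sc (of_int (sign \<sigma>)) (perm_mat m q k \<sigma> I J)))
    (q_antisym A m n q k b c)"
    unfolding q_antisym_def
    by (intro rep_smult rep_finsum rep_P_perm) (use assms in \<open>auto simp: finite_permutations\<close>)
  then show ?thesis by (rule rep_cong) (simp add: sym_mat_def)
qed

lemma free_gen_hom_part:
  assumes "i \<in> {1..m + n}" "j \<in> {1..m + n}"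
  shows "free_gen i j \<in> hom_part m n ((par m i + par m j) mod 2)"
  unfolding free_gen_def using assms by (intro hom_part_single) (auto simp: word_par_def)

lemma rep_M_op:
  assumes "1 \<le> a" "a \<le> k"
    and "\<And>i j. i \<in> {1..m + n} \<Longrightarrow> j \<in> {1..m + n} \<Longrightarrow> M i j = \<pi> (free_gen i j)"
  shows "rep k (M_mat m k a) (M_op A m n M k a)"
proof -
  have "M_op A m n M k a I J = \<pi> (sc ((- 1) ^ twist m k I J) (M_mat m k a I J))" 
    and "M_mat m k a I J \<in> hom_part m n (unit_par m k I J mod 2)"
    if I: "I \<in> multi_idx m n k" and J: "J \<in> multi_idx m n k" for I J
  proof -
    have ij: "I a \<in> {1..m + n}" "J a \<in> {1..m + n}"
      using assms multi_idx_mem[OF I] multi_idx_mem[OF J] by auto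
    have g: "free_gen (I a) (J a) \<in> hom_part m n ((par m (I a) + par m (J a)) mod 2)"
      using free_gen_hom_part[OF ij] .
    show "M_op A m n M k a I J = \<pi> (sc ((- 1) ^ twist m k I J) (M_mat m k a I J))" 
      using I J twist_single[OF assms(1,2), of I J m] pi_smult[OF hom_part_carrier[OF g]]
      by (auto simp: M_op_def M_mat_def pi_zero assms(3)[OF ij])
    show "M_mat m k a I J \<in> hom_part m n (unit_par m k I J mod 2)"
      using unit_par_single[OF assms(1,2), of I J m] g by (auto simp: M_mat_def)
  qed
  then show ?thesis
    unfolding rep_def by (auto simp: fun_eq_iff M_op_def)
qed

lemma matmul_M_mat:
  assumes "1 \<le> c" "c \<le> k" "I \<in> multi_idx m n k" "L \<in> multi_idx m n k"
  shows "matmul k (M_mat m k c) (M_tail m k (c + 1)) I L = M_tail m k c I L"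
proof -
  \<comment> \<open>The only intermediate index that contributes: \<open>M_mat\<close> can change
    position \<open>c\<close> alone, and the tail from \<open>c + 1\<close> on forces the value
    \<open>L c\<close> there.\<close>
  let ?J = "I(c := L c)"
  have J: "?J \<in> multi_idx m n k"
    using assms multi_idx_mem[OF assms(4), of c] by (intro multi_idx_upd) auto
  have zero: "M_mat m k c I J * M_tail m k (c + 1) J L = 0"
    if J': "J \<in> multi_idx m n k" and ne: "J \<noteq> ?J" for J
  proof (rule ccontr)
    assume "\<not> ?thesis"
    then have "\<forall>b \<in> {1..k} - {c}. I b = J b" "\<forall>b \<in> {1..<c+1}. J b = L b"
      unfolding M_mat_def M_tail_def by (auto split: if_splits)
    then have "J = ?J"
      using assms by (intro multi_idx_eqI[OF J' J]) auto
    with ne show False by blast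
  qed
  have "matmul k (M_mat m k c) (M_tail m k (c + 1)) I L = M_mat m k c I ?J * M_tail m k (c + 1) ?J L"
    unfolding matmul_def
    using sum.mono_neutral_right[of "multi_idx m n k" "{?J}" "\<lambda>J. M_mat m k c I J * M_tail m k (c + 1) J L"]
      J zero by auto
  also have "\<dots> = M_tail m k c I L"
  proof (cases "\<forall>b \<in> {1..<c}. I b = L b")
    case True
    have pairs: "idx_pairs ?J L (c + 1) k = idx_pairs I L (c + 1) k"
      unfolding idx_pairs_def by auto
    have cons: "idx_pairs I L c k = (I c, L c) # idx_pairs I L (c + 1) k"
      unfolding idx_pairs_def using assms by (subst upt_conv_Cons) (auto simp: Suc_eq_plus1)
    \<comment> \<open>To the right of \<open>c\<close> the columns of the single factor are the rows
      of the tail, so its sign is the one that \<open>sign_exp\<close> prescribes.\<close>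
    have s: "(\<Sum>z\<leftarrow>idx_pairs I L (c + 1) k. par m (fst z)) = (\<Sum>b = c+1..k. par m (?J b))"
      unfolding idx_pairs_def
      by (auto simp: comp_def interv_sum_list_conv_sum_set_nat intro!: sum.cong)
    have t: "\<forall>b\<in>{1..<c + 1}. ?J b = L b" using True by auto
    have m: "\<forall>b\<in>{1..k} - {c}. I b = ?J b" by auto
    have "M_mat m k c I ?J * M_tail m k (c + 1) ?J L =
      sc ((- 1) ^ ((par m (I c) + par m (L c)) * (\<Sum>b = c+1..k. par m (?J b))))
        (free_gen (I c) (L c)) * signed_word m (idx_pairs I L (c + 1) k)"
      unfolding M_mat_def M_tail_def if_P[OF t] if_P[OF m] pairs by simp
    also have "\<dots> = signed_word m (idx_pairs I L c k)"
      unfolding cons signed_word_def free_gen_def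
      by (simp add: s power_add mult_single plus_word_def)
    finally show ?thesis using True by (simp add: M_tail_def)
  next
    case False
    then have "\<not> (\<forall>b\<in>{1..<c + 1}. ?J b = L b)" by auto
    then show ?thesis using False unfolding M_tail_def by auto
  qed
  finally show ?thesis .
qed

lemma rep_M_tail:
  assumes "1 \<le> c" "c \<le> k + 1"
    and "\<And>i j. i \<in> {1..m + n} \<Longrightarrow> j \<in> {1..m + n} \<Longrightarrow> M i j = \<pi> (free_gen i j)"
  shows "rep k (M_tail m k c) (ordered_prod (tensor_End A m n k) (map (M_op A m n M k) [c..<k + 1]))"
  using assms(2,1)
proof (induction c rule: inc_induct)
  case base
  have "M_tail m k (k + 1) I J = (if I = J then 1 else 0)"
    if "I \<in> multi_idx m n k" "J \<in> multi_idx m n k" for I J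
  proof -
    have "(\<forall>b \<in> {1..<k+1}. I b = J b) \<longleftrightarrow> I = J"
      using multi_idx_eqI[OF that] by auto
    then show ?thesis
      by (simp add: M_tail_def idx_pairs_def signed_word_def zero_word_def[symmetric])
  qed
  then show ?case using rep_one[of k] by (auto elim!: rep_cong)
next
  case (step c)
  have "rep k (matmul k (M_mat m k c) (M_tail m k (c + 1)))
     (ordered_prod (tensor_End A m n k) (map (M_op A m n M k) [c..<k + 1]))"
    using step by (subst upt_conv_Cons) (auto intro!: rep_mult rep_M_op assms(3) simp: Suc_eq_plus1)
  then show ?case
    by (rule rep_cong) (use step in \<open>auto intro: matmul_M_mat\<close>)
qed

lemma matmul_perm_mat:
  assumes "q \<noteq> 0" "\<sigma> permutes {1..k}" "\<tau> permutes {1..k}" "I \<in> multi_idx m n k"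
  shows "matmul k (perm_mat m q k \<sigma>) (perm_mat m q k \<tau>) I L = perm_mat m q k (\<sigma> \<circ> \<tau>) I L"
proof -
  have "I \<circ> \<sigma> \<in> multi_idx m n k"
    using assms by (intro multi_idx_comp)
  then show ?thesis
    unfolding matmul_def perm_mat_def perm_coef_compose[OF assms(1-3)]
    by (simp add: if_distrib[of "\<lambda>z. z * _"] comp_assoc cong: if_cong del: comp_apply)
qed

end

section \<open>Supertraces as sums of words\<close>

text \<open>The f(\<sigma>) of the overview, lifted to the free algebra. The letters have rows
  \<open>I \<circ> \<sigma>\<close> and columns \<open>I\<close> because the only nonzero entry of
  \<open>perm_mat\<close> in row \<open>I\<close> sits in column
  \<open>I \<circ> \<sigma>\<close>.\<close>

definition trace_word :: "nat \<Rightarrow> nat \<Rightarrow> complex \<Rightarrow> nat \<Rightarrow> (nat \<Rightarrow> nat) \<Rightarrow> free_alg" where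
  "trace_word m n q k \<sigma> = (\<Sum>I\<in>multi_idx m n k.
    sc ((- 1) ^ (\<Sum>a = 1..k. par m (I a)) * perm_coef m q k I \<sigma>) (signed_word m (idx_pairs (I \<circ> \<sigma>) I 1 k)))"

context free_image
begin

lemma trace_perm_mat:
  assumes "\<sigma> permutes {1..k}"
  shows "(\<Sum>I\<in>multi_idx m n k. sc ((- 1) ^ (\<Sum>a = 1..k. par m (I a)))
      (matmul k (perm_mat m q k \<sigma>) (M_tail m k 1) I I)) = trace_word m n q k \<sigma>"
proof -
  have "matmul k (perm_mat m q k \<sigma>) (M_tail m k 1) I I
      = sc (perm_coef m q k I \<sigma>) (signed_word m (idx_pairs (I \<circ> \<sigma>) I 1 k))"
    if I: "I \<in> multi_idx m n k" for I
    using multi_idx_comp[OF I assms] unfolding matmul_def perm_mat_def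
    by (simp add: if_distrib[of "\<lambda>z. z * _"] M_tail_def cong: if_cong del: comp_apply)
  then show ?thesis unfolding trace_word_def by simp
qed

text \<open>Bilinear expansion of the two symmetrizers; \<open>matmul_perm_mat\<close> merges each
  pair of permutations into one.\<close>

lemma supertrace_sym_mat:
  assumes "q \<noteq> 0" "r \<le> k"
    and X: "rep k (sym_mat \<chi> m q k 1 r) X" and Y: "rep k (sym_mat \<chi>' m q k (r + 1) k) Y"
    and M: "rep k (M_tail m k 1) MM"
  shows "supertrace A m n k (X \<otimes>\<^bsub>tensor_End A m n k\<^esub> Y \<otimes>\<^bsub>tensor_End A m n k\<^esub> MM) =
    \<pi> (sc (1 / fact r * (1 / fact (k - r))) (\<Sum>\<sigma> | \<sigma> permutes {1..r}. \<Sum>\<tau> | \<tau> permutes {r+1..k}.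
      sc (\<chi> \<sigma> * \<chi>' \<tau>) (trace_word m n q k (\<sigma> \<circ> \<tau>))))"
proof -
  let ?K = "multi_idx m n k"
  let ?c = "1 / fact r * (1 / fact (k - r)) :: complex"
  let ?S = "{\<sigma>. \<sigma> permutes {1..r}}" and ?T = "{\<tau>. \<tau> permutes {r+1..k}}"
  have per: "\<sigma> permutes {1..k}" if "\<sigma> \<in> ?S" for \<sigma> :: "nat \<Rightarrow> nat"
    using that assms(2) by (auto intro: permutes_subset)
  have per': "\<tau> permutes {1..k}" if "\<tau> \<in> ?T" for \<tau> :: "nat \<Rightarrow> nat"
    using that assms(2) by (auto intro: permutes_subset)
  have prod: "matmul k (sym_mat \<chi> m q k 1 r) (sym_mat \<chi>' m q k (r + 1) k) I J =
      sc ?c (\<Sum>\<sigma>\<in>?S. \<Sum>\<tau>\<in>?T. sc (\<chi> \<sigma> * \<chi>' \<tau>) (perm_mat m q k (\<sigma> \<circ> \<tau>) I J))"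
    if I: "I \<in> ?K" for I J
  proof -
    have "matmul k (sym_mat \<chi> m q k 1 r) (sym_mat \<chi>' m q k (r + 1) k) I J
      = (\<Sum>L\<in>?K. \<Sum>\<sigma>\<in>?S. \<Sum>\<tau>\<in>?T. sc (?c * (\<chi> \<sigma> * \<chi>' \<tau>)) (perm_mat m q k \<sigma> I L * perm_mat m q k \<tau> L J))"
      unfolding matmul_def sym_mat_def
      by (simp only: sc_sum sc_sc sc_mult_left sc_mult_right sum_product) (simp add: mult_ac)
    also have "\<dots> = (\<Sum>\<sigma>\<in>?S. \<Sum>\<tau>\<in>?T. \<Sum>L\<in>?K. sc (?c * (\<chi> \<sigma> * \<chi>' \<tau>)) (perm_mat m q k \<sigma> I L * perm_mat m q k \<tau> L J))"
      by (subst sum.swap, rule sum.cong[OF refl], rule sum.swap)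
    also have "\<dots> = (\<Sum>\<sigma>\<in>?S. \<Sum>\<tau>\<in>?T. sc (?c * (\<chi> \<sigma> * \<chi>' \<tau>)) (perm_mat m q k (\<sigma> \<circ> \<tau>) I J))"
    proof (intro sum.cong refl)
      fix \<sigma> \<tau> :: "nat \<Rightarrow> nat" assume "\<sigma> \<in> ?S" "\<tau> \<in> ?T"
      then show "(\<Sum>L\<in>?K. sc (?c * (\<chi> \<sigma> * \<chi>' \<tau>)) (perm_mat m q k \<sigma> I L * perm_mat m q k \<tau> L J))
          = sc (?c * (\<chi> \<sigma> * \<chi>' \<tau>)) (perm_mat m q k (\<sigma> \<circ> \<tau>) I J)"
        using matmul_perm_mat[OF assms(1) per per' I, of \<sigma> \<tau> J] unfolding matmul_def by (simp flip: sc_sum)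
    qed
    finally show ?thesis by (simp add: sc_sum)
  qed
  have "supertrace A m n k (X \<otimes>\<^bsub>tensor_End A m n k\<^esub> Y \<otimes>\<^bsub>tensor_End A m n k\<^esub> MM) =
    \<pi> (\<Sum>I\<in>?K. sc ((- 1) ^ (\<Sum>a = 1..k. par m (I a)))
      (matmul k (matmul k (sym_mat \<chi> m q k 1 r) (sym_mat \<chi>' m q k (r + 1) k)) (M_tail m k 1) I I))"
    by (intro supertrace_rep rep_mult X Y M)
  also have "(\<Sum>I\<in>?K. sc ((- 1) ^ (\<Sum>a = 1..k. par m (I a)))
      (matmul k (matmul k (sym_mat \<chi> m q k 1 r) (sym_mat \<chi>' m q k (r + 1) k)) (M_tail m k 1) I I))
    = (\<Sum>I\<in>?K. \<Sum>\<sigma>\<in>?S. \<Sum>\<tau>\<in>?T. sc (?c * (\<chi> \<sigma> * \<chi>' \<tau>)) (sc ((- 1) ^ (\<Sum>a = 1..k. par m (I a)))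
        (matmul k (perm_mat m q k (\<sigma> \<circ> \<tau>)) (M_tail m k 1) I I)))"
  proof (rule sum.cong[OF refl])
    fix I assume I: "I \<in> ?K"
    have "matmul k (matmul k (sym_mat \<chi> m q k 1 r) (sym_mat \<chi>' m q k (r + 1) k)) (M_tail m k 1) I I
      = (\<Sum>J\<in>?K. \<Sum>\<sigma>\<in>?S. \<Sum>\<tau>\<in>?T. sc (?c * (\<chi> \<sigma> * \<chi>' \<tau>)) (perm_mat m q k (\<sigma> \<circ> \<tau>) I J * M_tail m k 1 J I))"
      unfolding matmul_def[of k "matmul k _ _"] prod[OF I] by (simp add: sc_sum sum_distrib_right)
    also have "\<dots> = (\<Sum>\<sigma>\<in>?S. \<Sum>\<tau>\<in>?T. \<Sum>J\<in>?K. sc (?c * (\<chi> \<sigma> * \<chi>' \<tau>)) (perm_mat m q k (\<sigma> \<circ> \<tau>) I J * M_tail m k 1 J I))"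
      by (subst sum.swap, rule sum.cong[OF refl], rule sum.swap)
    finally show "sc ((- 1) ^ (\<Sum>a = 1..k. par m (I a)))
      (matmul k (matmul k (sym_mat \<chi> m q k 1 r) (sym_mat \<chi>' m q k (r + 1) k)) (M_tail m k 1) I I)
      = (\<Sum>\<sigma>\<in>?S. \<Sum>\<tau>\<in>?T. sc (?c * (\<chi> \<sigma> * \<chi>' \<tau>)) (sc ((- 1) ^ (\<Sum>a = 1..k. par m (I a)))
        (matmul k (perm_mat m q k (\<sigma> \<circ> \<tau>)) (M_tail m k 1) I I)))"
      by (simp only: matmul_def sc_sum sc_sc mult.commute)
  qed
  also have "\<dots> = (\<Sum>\<sigma>\<in>?S. \<Sum>\<tau>\<in>?T. \<Sum>I\<in>?K. sc (?c * (\<chi> \<sigma> * \<chi>' \<tau>)) (sc ((- 1) ^ (\<Sum>a = 1..k. par m (I a)))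
        (matmul k (perm_mat m q k (\<sigma> \<circ> \<tau>)) (M_tail m k 1) I I)))"
    by (subst sum.swap, rule sum.cong[OF refl], rule sum.swap)
  also have "\<dots> = (\<Sum>\<sigma>\<in>?S. \<Sum>\<tau>\<in>?T. sc (?c * (\<chi> \<sigma> * \<chi>' \<tau>)) (trace_word m n q k (\<sigma> \<circ> \<tau>)))"
    unfolding sc_sum[symmetric]
    by (intro sum.cong refl arg_cong2[of _ _ _ _ sc] trace_perm_mat permutes_compose per per')
  also have "\<dots> = sc ?c (\<Sum>\<sigma>\<in>?S. \<Sum>\<tau>\<in>?T. sc (\<chi> \<sigma> * \<chi>' \<tau>) (trace_word m n q k (\<sigma> \<circ> \<tau>)))"
    by (simp add: sc_sum)
  finally show ?thesis .
qed

end


section \<open>The right quantum relations\<close>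

lemma part_zero: "part m p 0 = 0"
  by (simp add: part_def)

lemma component_free:
  assumes "p \<in> {0, 1}" "f \<in> free_carrier m n"
  shows "component (free_superalgebra m n) p f = part m p f"
  unfolding component_def free_superalgebra_simps
proof (rule the_equality)
  have "part m p f + part m (1 - p) f = f"
    using assms(1) part_decomp[of m f] by (auto simp: add.commute)
  then show "part m p f \<in> hom_part m n p \<and> (\<exists>z\<in>hom_part m n (1 - p). f = part m p f + z)"
    using part_hom_part[OF assms(2)] by metis
next
  fix y assume "y \<in> hom_part m n p \<and> (\<exists>z\<in>hom_part m n (1 - p). f = y + z)"
  then obtain z where y: "y \<in> hom_part m n p" and z: "z \<in> hom_part m n (1 - p)" and f: "f = y + z" by blast
  have "p \<noteq> 1 - p" using assms(1) by auto
  then show "y = part m p f"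
    unfolding f part_add part_hom[OF y] part_hom[OF z] by simp
qed

lemma free_image_free: "free_image m n (free_superalgebra m n) (\<lambda>f. f)"
proof (rule free_image.intro)
  show "abelian_monoid (free_superalgebra m n)"
    using free_ring ring.is_abelian_group abelian_group.axioms(1) by blast
  show "component (free_superalgebra m n) p f = (if p = p' then f else 0)"
    if "p \<in> {0, 1}" "p' \<in> {0, 1}" "f \<in> hom_part m n p'" for p p' f
    using component_free[OF that(1) hom_part_carrier[OF that(3)]] part_hom[OF that(3), of p] by auto
qed (simp_all add: free_superalgebra_simps)

section \<open>Entries of the defining relation\<close>

text \<open>The untwisted entry of \<open>(1 - P)M\<^sub>1M\<^sub>2(1 + P)\<close> in row
  \<open>(j, j')\<close> and column \<open>(i, i')\<close>. The left factor exchanges rows, the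
  right one columns; the column weight has its arguments reversed because the entry of P is read at
  the exchanged column.\<close>

definition local_rel :: "nat \<Rightarrow> complex \<Rightarrow> nat \<Rightarrow> nat \<Rightarrow> nat \<Rightarrow> nat \<Rightarrow> free_alg" where
  "local_rel m q j j' i i' = signed_word m [(j, i), (j', i')]
    + sc (swap_wt m q i' i) (signed_word m [(j, i'), (j', i)])
    - sc (swap_wt m q j j') (signed_word m [(j', i), (j, i')]
        + sc (swap_wt m q i' i) (signed_word m [(j', i'), (j, i)]))"

context free_image
begin

lemma matmul_assoc: "matmul k (matmul k x y) z I L = matmul k x (matmul k y z) I L"
proof -
  have "matmul k (matmul k x y) z I L = (\<Sum>b\<in>multi_idx m n k. \<Sum>a\<in>multi_idx m n k. x I a * y a b * z b L)"
    unfolding matmul_def by (simp add: sum_distrib_right)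
  also have "\<dots> = (\<Sum>a\<in>multi_idx m n k. \<Sum>b\<in>multi_idx m n k. x I a * y a b * z b L)"
    by (rule sum.swap)
  also have "\<dots> = matmul k x (matmul k y z) I L"
    unfolding matmul_def by (simp add: sum_distrib_left mult.assoc)
  finally show ?thesis .
qed

lemma matmul_cong:
  assumes "\<And>J. J \<in> multi_idx m n k \<Longrightarrow> x I J = x' I J" "\<And>J. J \<in> multi_idx m n k \<Longrightarrow> y J L = y' J L"
  shows "matmul k x y I L = matmul k x' y' I L"
  unfolding matmul_def using assms by simp

lemma matmul_id_plus_left:
  assumes "I \<in> multi_idx m n k"
  shows "matmul k (\<lambda>I J. (if I = J then 1 else 0) + x I J) y I L = y I L + matmul k x y I L"
  using assms unfolding matmul_def
  by (simp add: distrib_right sum.distrib if_distrib[of "\<lambda>z. z * _"] cong: if_cong)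

lemma matmul_id_plus_right:
  assumes "L \<in> multi_idx m n k"
  shows "matmul k y (\<lambda>I J. (if I = J then 1 else 0) + x I J) I L = y I L + matmul k y x I L"
  using assms unfolding matmul_def
  by (simp add: distrib_left sum.distrib if_distrib[of "\<lambda>z. _ * z"] cong: if_cong)

lemma matmul_id_right:
  assumes "L \<in> multi_idx m n k"
  shows "matmul k y (\<lambda>I J. if I = J then 1 else 0) I L = y I L"
  using assms unfolding matmul_def
  by (simp add: if_distrib[of "\<lambda>z. _ * z"] cong: if_cong)

lemma matmul_swap_right:
  assumes "1 \<le> a" "a < k" "L \<in> multi_idx m n k"
  shows "matmul k x (swap_mat m q a) I L = sc (swap_wt m q (L (a + 1)) (L a)) (x I (L \<circ> adj a))"
proof -
  have L: "L \<circ> adj a \<in> multi_idx m n k"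
    using assms by (intro multi_idx_comp adj_permutes) auto
  have "L = J \<circ> adj a \<longleftrightarrow> J = L \<circ> adj a" for J
    by (auto simp: comp_assoc simp del: comp_apply)
  then have "x I J * swap_mat m q a J L = (if J = L \<circ> adj a then x I J * sc (swap_wt m q (J a) (J (a + 1))) 1 else 0)" for J
    unfolding swap_mat_def by simp
  then show ?thesis
    unfolding matmul_def using L by (simp cong: if_cong)
qed

end

context
  fixes m n :: nat
begin

interpretation F: free_image m n "free_superalgebra m n" "\<lambda>f. f"
  by (rule free_image_free)

text \<open>\<open>ordered_prod\<close> is a right fold that ends in the unit, which accounts for
  the last factor; \<open>F.matmul_id_right\<close> disposes of it below.\<close>

lemma rep_right_quantum:
  "F.rep 2 (F.matmul 2 (\<lambda>I J. (if I = J then 1 else 0) + sc (- 1) (swap_mat m q 1 I J))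
    (F.matmul 2 (M_mat m 2 1) (F.matmul 2 (M_mat m 2 2)
      (F.matmul 2 (\<lambda>I J. (if I = J then 1 else 0) + swap_mat m q 1 I J) (\<lambda>I J. if I = J then 1 else 0)))))
    (right_quantum_element (free_superalgebra m n) m n q free_gen)"
  unfolding right_quantum_element_def Let_def ordered_prod_Cons ordered_prod_Nil
  by (intro F.rep_mult F.rep_add F.rep_one F.rep_smult F.rep_P_op F.rep_M_op) auto

lemma right_quantum_entry:
  assumes "J \<in> multi_idx m n 2" "I \<in> multi_idx m n 2"
  shows "right_quantum_element (free_superalgebra m n) m n q free_gen J I =
      sc ((- 1) ^ twist m 2 J I) (local_rel m q (J 1) (J 2) (I 1) (I 2))"
    and "right_quantum_element (free_superalgebra m n) m n q free_gen J I \<in>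
      hom_part m n (unit_par m 2 J I mod 2)"
proof -
  let ?\<delta> = "\<lambda>I J. if I = J then 1 else 0 :: free_alg" and ?S = "swap_mat m q 1"
  let ?K = "multi_idx m n 2"
  let ?r = "F.matmul 2 (\<lambda>I J. ?\<delta> I J + ?S I J) ?\<delta>"
  let ?y = "F.matmul 2 (M_mat m 2 1) (F.matmul 2 (M_mat m 2 2) ?r)"
  have n2: "1 + 1 = (2::nat)" "{1..<2} = {1::nat}" "[1..<3] = [1, 2::nat]" "[2..<3] = [2::nat]"
    by (auto simp: numeral_eq_Suc One_nat_def)
  have M2: "M_mat m 2 2 I L = M_tail m 2 2 I L" for I L
  proof -
    have "{1..2} - {2} = {1::nat}" by auto
    then show ?thesis
      by (simp add: M_mat_def M_tail_def n2 idx_pairs_def signed_word_def free_gen_def)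
  qed
  have MM: "F.matmul 2 (M_mat m 2 1) (M_mat m 2 2) I L = signed_word m [(I 1, L 1), (I 2, L 2)]"
    if "I \<in> ?K" "L \<in> ?K" for I L
  proof -
    have "F.matmul 2 (M_mat m 2 1) (M_mat m 2 2) I L = M_tail m 2 1 I L"
      using F.matmul_M_mat[of 1 2 I L] that M2 unfolding n2 F.matmul_def by simp
    then show ?thesis by (simp add: M_tail_def idx_pairs_def n2)
  qed
  have adj2: "(L \<circ> adj 1) 1 = L 2" "(L \<circ> adj 1) 2 = L 1" for L :: "nat \<Rightarrow> nat"
    by (simp_all add: n2 transpose_def)
  have adjK: "L \<circ> adj 1 \<in> ?K" if "L \<in> ?K" for L
    using that by (intro multi_idx_comp adj_permutes) auto
  have y: "?y J I = signed_word m [(J 1, I 1), (J 2, I 2)]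
      + sc (swap_wt m q (I 2) (I 1)) (signed_word m [(J 1, I 2), (J 2, I 1)])"
    if J: "J \<in> ?K" and I: "I \<in> ?K" for J I
  proof -
    have "?y J I = F.matmul 2 (F.matmul 2 (M_mat m 2 1) (M_mat m 2 2)) ?r J I"
      by (rule F.matmul_assoc[symmetric])
    also have "\<dots> = F.matmul 2 (F.matmul 2 (M_mat m 2 1) (M_mat m 2 2)) (\<lambda>I J. ?\<delta> I J + ?S I J) J I"
      using I by (intro F.matmul_cong refl F.matmul_id_right)
    also have "\<dots> = signed_word m [(J 1, I 1), (J 2, I 2)]
      + sc (swap_wt m q (I 2) (I 1)) (signed_word m [(J 1, I 2), (J 2, I 1)])"
      unfolding F.matmul_id_plus_right[OF I] using F.matmul_swap_right[of 1 2 I] I J adjK[OF I]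
      by (simp add: MM adj2[unfolded n2] n2 del: comp_apply)
    finally show ?thesis .
  qed
  have "F.matmul 2 (\<lambda>I J. ?\<delta> I J + sc (- 1) (?S I J)) ?y J I = ?y J I - F.matmul 2 ?S ?y J I"
    unfolding F.matmul_id_plus_left[OF assms(1)]
    by (simp add: F.matmul_def sc_minus_one sum_negf)
  also have "F.matmul 2 ?S ?y J I = sc (swap_wt m q (J 1) (J 2)) (?y (J \<circ> adj 1) I)"
    using F.matmul_swap[of 1 2 J] assms by (simp add: n2 del: comp_apply)
  finally have "F.matmul 2 (\<lambda>I J. ?\<delta> I J + sc (- 1) (?S I J)) ?y J I = local_rel m q (J 1) (J 2) (I 1) (I 2)"
    unfolding y[OF assms] y[OF adjK[OF assms(1)] assms(2)] adj2 local_rel_def .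
  then show "right_quantum_element (free_superalgebra m n) m n q free_gen J I =
      sc ((- 1) ^ twist m 2 J I) (local_rel m q (J 1) (J 2) (I 1) (I 2))"
      and "right_quantum_element (free_superalgebra m n) m n q free_gen J I \<in>
      hom_part m n (unit_par m 2 J I mod 2)"
    using F.rep_entry[OF rep_right_quantum assms, of q] F.rep_hom[OF rep_right_quantum assms, of q]
    by auto
qed

end

section \<open>The ideal of relations and its quotient\<close>

lemma free_a_inv: "f \<in> free_carrier m n \<Longrightarrow> \<ominus>\<^bsub>free_superalgebra m n\<^esub> f = - f"
proof -
  assume f: "f \<in> free_carrier m n"
  interpret ring "free_superalgebra m n" by (rule free_ring)
  show ?thesis
    using f by (intro minus_equality) (auto simp: free_superalgebra_simps)
qed

lemma right_quantum_ideal: "ideal (right_quantum_ideal m n q) (free_superalgebra m n)"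
proof -
  interpret ring "free_superalgebra m n" by (rule free_ring)
  show ?thesis
    unfolding right_quantum_ideal_def
    by (rule genideal_ideal) (auto simp: free_superalgebra_simps hom_part_carrier[OF right_quantum_entry(2)])
qed

context
  fixes m n :: nat and q :: complex
begin

abbreviation "RI \<equiv> right_quantum_ideal m n q"

lemma RI_carrier: "f \<in> RI \<Longrightarrow> f \<in> free_carrier m n"
  using ideal.Icarr[OF right_quantum_ideal] by (simp add: free_superalgebra_simps)

lemma RI_zero: "0 \<in> RI"
  using additive_subgroup.zero_closed[OF ideal.axioms(1)[OF right_quantum_ideal]]
  by (simp add: free_superalgebra_simps)

lemma RI_add: "f \<in> RI \<Longrightarrow> g \<in> RI \<Longrightarrow> f + g \<in> RI"
  using additive_subgroup.a_closed[OF ideal.axioms(1)[OF right_quantum_ideal]]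
  by (simp add: free_superalgebra_simps)

lemma RI_uminus: "f \<in> RI \<Longrightarrow> - f \<in> RI"
  using additive_subgroup.a_inv_closed[OF ideal.axioms(1)[OF right_quantum_ideal]] RI_carrier
  by (metis free_a_inv)

lemma RI_diff: "f \<in> RI \<Longrightarrow> g \<in> RI \<Longrightarrow> f - g \<in> RI"
  using RI_add[OF _ RI_uminus] by fastforce

lemma RI_mult_left: "f \<in> RI \<Longrightarrow> g \<in> free_carrier m n \<Longrightarrow> g * f \<in> RI"
  using ideal.I_l_closed[OF right_quantum_ideal] by (simp add: free_superalgebra_simps)

lemma RI_mult_right: "f \<in> RI \<Longrightarrow> g \<in> free_carrier m n \<Longrightarrow> f * g \<in> RI"
  using ideal.I_r_closed[OF right_quantum_ideal] by (simp add: free_superalgebra_simps)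

lemma RI_sc: "f \<in> RI \<Longrightarrow> sc c f \<in> RI"
  using RI_mult_left[of f "sc c 1"] by (auto intro: free_carrier_sc)

lemma RI_subspace: "sc.subspace RI"
  by (auto simp: sc.subspace_def RI_zero RI_add RI_sc)

text \<open>
  The ideal is homogeneous, so \<open>component\<close> (a definite description) is well defined in the quotient.
\<close>

lemma RI_part:
  assumes "f \<in> RI" "p \<in> {0, 1}"
  shows "part m p f \<in> RI"
proof -
  interpret ring "free_superalgebra m n" by (rule free_ring)
  \<comment> \<open>These elements form an ideal by the parity rule for products, and it contains
    the generators since each of them is homogeneous; minimality of \<open>RI\<close> does the
    rest.\<close>
  let ?H = "{f \<in> free_carrier m n. part m 0 f \<in> RI \<and> part m 1 f \<in> RI}"
  have "ideal ?H (free_superalgebra m n)"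
  proof (rule idealI[OF free_ring])
    show "subgroup ?H (add_monoid (free_superalgebra m n))"
    proof
      fix f assume "f \<in> ?H"
      then show "inv\<^bsub>add_monoid (free_superalgebra m n)\<^esub> f \<in> ?H"
        using free_a_inv[of f m n] by (auto simp: a_inv_def part_uminus RI_uminus free_carrier_uminus)
    qed (auto simp: free_superalgebra_simps part_add RI_add part_zero RI_zero free_carrier_add)
  next
    fix f g assume "f \<in> ?H" "g \<in> carrier (free_superalgebra m n)"
    moreover from this have "part m p g \<in> free_carrier m n" for p
      by (intro hom_part_carrier[OF part_hom_part]) (simp add: free_superalgebra_simps)
    ultimately have "part m a f * part m b g \<in> RI" "part m b g * part m a f \<in> RI"
      if "a \<in> {0, 1}" for a b
      using that RI_mult_left[of "part m a f"] RI_mult_right[of "part m a f"] by auto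
    then show "g \<otimes>\<^bsub>free_superalgebra m n\<^esub> f \<in> ?H" "f \<otimes>\<^bsub>free_superalgebra m n\<^esub> g \<in> ?H"
      using \<open>f \<in> ?H\<close> \<open>g \<in> carrier (free_superalgebra m n)\<close>
      by (simp_all add: free_superalgebra_simps part_mult[of f m n g] part_mult[of g m n f]
        free_carrier_mult RI_add)
  qed
  moreover have "{right_quantum_element (free_superalgebra m n) m n q free_gen I J | I J.
        I \<in> multi_idx m n 2 \<and> J \<in> multi_idx m n 2} \<subseteq> ?H"
  proof clarify
    fix I J assume IJ: "I \<in> multi_idx m n 2" "J \<in> multi_idx m n 2"
    let ?f = "right_quantum_element (free_superalgebra m n) m n q free_gen I J"
    have f: "?f \<in> hom_part m n (unit_par m 2 I J mod 2)"
      by (rule right_quantum_entry(2)[OF IJ])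
    have "{right_quantum_element (free_superalgebra m n) m n q free_gen I J | I J.
        I \<in> multi_idx m n 2 \<and> J \<in> multi_idx m n 2} \<subseteq> RI"
      unfolding right_quantum_ideal_def
      by (rule genideal_self) (auto simp: free_superalgebra_simps hom_part_carrier[OF right_quantum_entry(2)])
    then have "?f \<in> RI" using IJ by blast
    then show "?f \<in> free_carrier m n \<and> part m 0 ?f \<in> RI \<and> part m 1 ?f \<in> RI"
      using part_hom[OF f] RI_zero RI_carrier by auto
  qed
  ultimately have "RI \<subseteq> ?H"
    unfolding right_quantum_ideal_def[of m n q] by (rule genideal_minimal)
  then show ?thesis using assms by auto
qed

lemma local_rel_RI:
  assumes "{j, j', i, i'} \<subseteq> {1..m + n}"
  shows "local_rel m q j j' i i' \<in> RI"
proof -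
  interpret ring "free_superalgebra m n" by (rule free_ring)
  \<comment> \<open>The value \<open>undefined\<close> away from 1 and 2 makes the index
    extensional, as \<open>multi_idx\<close> demands.\<close>
  let ?idx = "\<lambda>x y a. if a = 1 then x else if a = 2 then y else undefined :: nat"
  have K: "?idx j j' \<in> multi_idx m n 2" "?idx i i' \<in> multi_idx m n 2"
    using assms by (auto simp: multi_idx_def PiE_iff extensional_def)
  let ?f = "right_quantum_element (free_superalgebra m n) m n q free_gen (?idx j j') (?idx i i')"
  have "{right_quantum_element (free_superalgebra m n) m n q free_gen I J | I J.
        I \<in> multi_idx m n 2 \<and> J \<in> multi_idx m n 2} \<subseteq> RI"
    unfolding right_quantum_ideal_def
    by (rule genideal_self) (auto simp: free_superalgebra_simps hom_part_carrier[OF right_quantum_entry(2)])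
  then have "?f \<in> RI" using K by blast
  \<comment> \<open>The twist sign squares to 1, so multiplying by it once more removes it.\<close>
  then have "sc ((- 1) ^ twist m 2 (?idx j j') (?idx i i')) ?f \<in> RI" by (rule RI_sc)
  then show ?thesis
    unfolding right_quantum_entry(1)[OF K] by (simp flip: power_mult_distrib)
qed

lemma coset_eq: "RI +>\<^bsub>free_superalgebra m n\<^esub> f = (\<lambda>h. h + f) ` RI"
  by (auto simp: a_r_coset_def' free_superalgebra_simps)

lemma coset_eq_iff:
  "RI +>\<^bsub>free_superalgebra m n\<^esub> f = RI +>\<^bsub>free_superalgebra m n\<^esub> g \<longleftrightarrow> f - g \<in> RI"
proof
  assume "RI +>\<^bsub>free_superalgebra m n\<^esub> f = RI +>\<^bsub>free_superalgebra m n\<^esub> g"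
  then have "f \<in> (\<lambda>h. h + g) ` RI" unfolding coset_eq using RI_zero by force
  then show "f - g \<in> RI" by auto
next
  assume fg: "f - g \<in> RI"
  have "h + f \<in> (\<lambda>h. h + g) ` RI" if "h \<in> RI" for h
    using RI_add[OF that fg] by (auto simp: image_iff algebra_simps intro!: bexI[of _ "h + (f - g)"])
  moreover have "h + g \<in> (\<lambda>h. h + f) ` RI" if "h \<in> RI" for h
    using RI_diff[OF that fg] by (auto simp: image_iff algebra_simps intro!: bexI[of _ "h - (f - g)"])
  ultimately show "RI +>\<^bsub>free_superalgebra m n\<^esub> f = RI +>\<^bsub>free_superalgebra m n\<^esub> g"
    unfolding coset_eq by blast
qed

lemma right_quantum_simps:
  "carrier (right_quantum_superalgebra m n q) = carrier (free_superalgebra m n Quot RI)"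
  "mult (right_quantum_superalgebra m n q) = mult (free_superalgebra m n Quot RI)"
  "one (right_quantum_superalgebra m n q) = one (free_superalgebra m n Quot RI)"
  "zero (right_quantum_superalgebra m n q) = zero (free_superalgebra m n Quot RI)"
  "add (right_quantum_superalgebra m n q) = add (free_superalgebra m n Quot RI)"
  "smult (right_quantum_superalgebra m n q) = (\<lambda>c X. \<Union>x\<in>X. RI +>\<^bsub>free_superalgebra m n\<^esub> sc c x)"
  "homog (right_quantum_superalgebra m n q) = (\<lambda>p. (+>\<^bsub>free_superalgebra m n\<^esub>) RI ` hom_part m n p)"
  by (simp_all add: right_quantum_superalgebra_def quotient_superalgebra_def free_superalgebra_simps)

lemma free_image_quotient:
  "free_image m n (right_quantum_superalgebra m n q) (\<lambda>f. RI +>\<^bsub>free_superalgebra m n\<^esub> f)"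
proof (rule free_image.intro)
  let ?R = "right_quantum_superalgebra m n q" and ?F = "free_superalgebra m n"
  have hom: "(+>\<^bsub>?F\<^esub>) RI \<in> ring_hom ?F (?F Quot RI)"
    by (rule ideal.rcos_ring_hom[OF right_quantum_ideal])
  interpret Q: ring "?F Quot RI"
    by (rule ideal.quotient_is_ring[OF right_quantum_ideal])
  show R: "abelian_monoid ?R"
    by (rule abelian_monoidI) (simp_all add: right_quantum_simps Q.a_ac)
  show carr: "RI +>\<^bsub>?F\<^esub> f \<in> carrier ?R" if "f \<in> free_carrier m n" for f
    using ring_hom_closed[OF hom] that by (simp add: right_quantum_simps free_superalgebra_simps)
  show add: "RI +>\<^bsub>?F\<^esub> (f + g) = (RI +>\<^bsub>?F\<^esub> f) \<oplus>\<^bsub>?R\<^esub> (RI +>\<^bsub>?F\<^esub> g)"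
    if "f \<in> free_carrier m n" "g \<in> free_carrier m n" for f g
    using ring_hom_add[OF hom, of f g] that by (simp add: right_quantum_simps free_superalgebra_simps)
  show "RI +>\<^bsub>?F\<^esub> (f * g) = (RI +>\<^bsub>?F\<^esub> f) \<otimes>\<^bsub>?R\<^esub> (RI +>\<^bsub>?F\<^esub> g)"
    if "f \<in> free_carrier m n" "g \<in> free_carrier m n" for f g
    using ring_hom_mult[OF hom, of f g] that by (simp add: right_quantum_simps free_superalgebra_simps)
  show "RI +>\<^bsub>?F\<^esub> 1 = \<one>\<^bsub>?R\<^esub>"
    using ring_hom_one[OF hom] by (simp add: right_quantum_simps free_superalgebra_simps)
  show "RI +>\<^bsub>?F\<^esub> 0 = \<zero>\<^bsub>?R\<^esub>"
    unfolding coset_eq by (simp add: right_quantum_simps FactRing_def)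
  show "RI +>\<^bsub>?F\<^esub> sc c f = c \<odot>\<^bsub>?R\<^esub> (RI +>\<^bsub>?F\<^esub> f)" if "f \<in> free_carrier m n" for c f
  proof -
    \<comment> \<open>The scalar multiple of a coset is a union over all representatives; they all
      give one coset because the ideal is closed under scalars.\<close>
    have "RI +>\<^bsub>?F\<^esub> sc c x = RI +>\<^bsub>?F\<^esub> sc c f" if "x \<in> RI +>\<^bsub>?F\<^esub> f" for x
      using that RI_sc[of _ c] unfolding coset_eq_iff by (auto simp: coset_eq sc_add)
    moreover have "f \<in> RI +>\<^bsub>?F\<^esub> f" unfolding coset_eq using RI_zero by force
    ultimately show ?thesis unfolding right_quantum_simps by blast
  qed
  show "component ?R p (RI +>\<^bsub>?F\<^esub> f) = RI +>\<^bsub>?F\<^esub> (if p = p' then f else 0)"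
    if p: "p \<in> {0, 1}" "p' \<in> {0, 1}" and f: "f \<in> hom_part m n p'" for p p' f
  proof -
    have fc: "f \<in> free_carrier m n" using f by (rule hom_part_carrier)
    have "component ?R p (RI +>\<^bsub>?F\<^esub> f) = RI +>\<^bsub>?F\<^esub> part m p f"
      unfolding component_def
    proof (rule the_equality)
      have dec: "part m p f + part m (1 - p) f = f"
        using p(1) part_decomp[of m f] by (auto simp: add.commute)
      have h: "part m p f \<in> hom_part m n p" "part m (1 - p) f \<in> hom_part m n (1 - p)"
        using part_hom_part[OF fc] by auto
      moreover have "RI +>\<^bsub>?F\<^esub> f = (RI +>\<^bsub>?F\<^esub> part m p f) \<oplus>\<^bsub>?R\<^esub> (RI +>\<^bsub>?F\<^esub> part m (1 - p) f)"
        unfolding add[OF h[THEN hom_part_carrier], symmetric] dec ..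
      ultimately show "RI +>\<^bsub>?F\<^esub> part m p f \<in> homog ?R p \<and>
          (\<exists>z\<in>homog ?R (1 - p). RI +>\<^bsub>?F\<^esub> f = (RI +>\<^bsub>?F\<^esub> part m p f) \<oplus>\<^bsub>?R\<^esub> z)"
        unfolding right_quantum_simps(7) by blast
    next
      fix y assume "y \<in> homog ?R p \<and> (\<exists>z\<in>homog ?R (1 - p). RI +>\<^bsub>?F\<^esub> f = y \<oplus>\<^bsub>?R\<^esub> z)"
      then obtain g h where g: "g \<in> hom_part m n p" and h: "h \<in> hom_part m n (1 - p)"
        and y: "y = RI +>\<^bsub>?F\<^esub> g" and "RI +>\<^bsub>?F\<^esub> f = (RI +>\<^bsub>?F\<^esub> g) \<oplus>\<^bsub>?R\<^esub> (RI +>\<^bsub>?F\<^esub> h)"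
        unfolding right_quantum_simps(7) by blast
      then have "RI +>\<^bsub>?F\<^esub> (g + h) = RI +>\<^bsub>?F\<^esub> f"
        using add[OF g[THEN hom_part_carrier] h[THEN hom_part_carrier]] by simp
      \<comment> \<open>Uniqueness of the component is where homogeneity of the ideal enters: the
        difference of two decompositions is projected to parity \<open>p\<close>.\<close>
      then have "part m p (g + h - f) \<in> RI"
        unfolding coset_eq_iff using p(1) by (rule RI_part)
      moreover have "p \<noteq> 1 - p" using p by auto
      ultimately have "g - part m p f \<in> RI"
        using part_hom[OF g, of p] part_hom[OF h, of p]
        by (simp add: part_add part_uminus diff_conv_add_uminus del: add_uminus_conv_diff)
      then show "y = RI +>\<^bsub>?F\<^esub> part m p f" unfolding y coset_eq_iff .
    qed
    then show ?thesis using part_hom[OF f, of p] by auto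
  qed
qed

end

section \<open>The relations inside longer words\<close>

lemma sign_exp_append:
  "sign_exp m (xs @ ys) = sign_exp m xs +
    (\<Sum>z\<leftarrow>xs. par m (fst z) + par m (snd z)) * (\<Sum>z\<leftarrow>ys. par m (fst z)) + sign_exp m ys"
  by (induction xs) (simp_all add: algebra_simps)

lemma signed_word_append:
  "signed_word m (xs @ ys) =
    sc ((- 1) ^ ((\<Sum>z\<leftarrow>xs. par m (fst z) + par m (snd z)) * (\<Sum>z\<leftarrow>ys. par m (fst z))))
      (signed_word m xs * signed_word m ys)"
proof -
  have w: "Poly_Mapping.single (Word (xs @ ys)) 1 =
      Poly_Mapping.single (Word xs) 1 * (Poly_Mapping.single (Word ys) 1 :: free_alg)"
    by (simp add: mult_single plus_word_def)
  show ?thesis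
    unfolding signed_word_def sign_exp_append w
    by (simp only: sc_mult_left sc_mult_right sc_sc power_add mult.commute mult.left_commute mult.assoc)
qed

lemma signed_word_carrier:
  "set zs \<subseteq> {1..m + n} \<times> {1..m + n} \<Longrightarrow> signed_word m zs \<in> free_carrier m n"
  unfolding signed_word_def by (intro free_carrier_sc) (auto simp: mem_free_carrier)

text \<open>The four words differ only in how two rows are matched with two columns, so the
  surrounding \<open>u\<close> and \<open>v\<close> contribute the same sign to each, and the claim
  is a multiple of \<open>local_rel\<close> inside the ideal.\<close>

lemma signed_word_rel:
  assumes "{j, j', i, i'} \<subseteq> {1..m + n}"
    and "set u \<subseteq> {1..m + n} \<times> {1..m + n}" "set v \<subseteq> {1..m + n} \<times> {1..m + n}"
  shows "signed_word m (u @ [(j, i), (j', i')] @ v)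
    + sc (swap_wt m q i' i) (signed_word m (u @ [(j, i'), (j', i)] @ v))
    - sc (swap_wt m q j j') (signed_word m (u @ [(j', i), (j, i')] @ v)
        + sc (swap_wt m q i' i) (signed_word m (u @ [(j', i'), (j, i)] @ v))) \<in> right_quantum_ideal m n q"
proof -
  define s where "s = (\<Sum>z\<leftarrow>u. par m (fst z) + par m (snd z))"
  define t where "t = (\<Sum>z\<leftarrow>v. par m (fst z))"
  \<comment> \<open>The first factor is the sign of \<open>u\<close> against all rows to its right,
    the second that of the two middle letters against the rows of \<open>v\<close>.\<close>
  define c :: complex where "c = (- 1) ^ (s * (par m j + par m j' + t)) *
      (- 1) ^ ((par m j + par m i + (par m j' + par m i')) * t)"
  have w: "signed_word m (u @ [x, y] @ v) = sc c (signed_word m u * signed_word m [x, y] * signed_word m v)"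
    if "par m (fst x) + par m (fst y) = par m j + par m j'"
      "par m (fst x) + par m (snd x) + (par m (fst y) + par m (snd y)) = par m j + par m i + (par m j' + par m i')"
    for x y
    unfolding signed_word_append[of m u] signed_word_append[of m "[x, y]"] s_def[symmetric] c_def
    using that by (simp add: t_def[symmetric] mult.assoc flip: add.assoc)
  have "sc c (signed_word m u * local_rel m q j j' i i' * signed_word m v) \<in> right_quantum_ideal m n q"
    using assms by (intro RI_sc RI_mult_right RI_mult_left local_rel_RI signed_word_carrier)
  also have "sc c (signed_word m u * local_rel m q j j' i i' * signed_word m v) =
    signed_word m (u @ [(j, i), (j', i')] @ v)
    + sc (swap_wt m q i' i) (signed_word m (u @ [(j, i'), (j', i)] @ v))
    - sc (swap_wt m q j j') (signed_word m (u @ [(j', i), (j, i')] @ v)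
        + sc (swap_wt m q i' i) (signed_word m (u @ [(j', i'), (j, i)] @ v)))"
  proof -
    have ws: "signed_word m (u @ [(j, i), (j', i')] @ v) = sc c (signed_word m u * signed_word m [(j, i), (j', i')] * signed_word m v)"
      "signed_word m (u @ [(j, i'), (j', i)] @ v) = sc c (signed_word m u * signed_word m [(j, i'), (j', i)] * signed_word m v)"
      "signed_word m (u @ [(j', i), (j, i')] @ v) = sc c (signed_word m u * signed_word m [(j', i), (j, i')] * signed_word m v)"
      "signed_word m (u @ [(j', i'), (j, i)] @ v) = sc c (signed_word m u * signed_word m [(j', i'), (j, i)] * signed_word m v)"
      by (intro w; simp)+
    show ?thesis
      unfolding ws local_rel_def
      by (simp only: distrib_left distrib_right left_diff_distrib right_diff_distrib sc_add
        sc.scale_right_diff_distrib sc_mult_left sc_mult_right sc_sc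
        mult.commute mult.left_commute mult.assoc)
  qed
  finally show ?thesis .
qed


section \<open>The master theorem\<close>

lemma idx_pairs_split:
  assumes "1 \<le> a" "a < k"
  shows "idx_pairs I J 1 k = map (\<lambda>b. (I b, J b)) [1..<a] @
    [(I a, J a), (I (a + 1), J (a + 1))] @ map (\<lambda>b. (I b, J b)) [a+2..<k+1]"
proof -
  have "[1..<k+1] = [1..<a] @ [a..<k+1]"
    using assms upt_add_eq_append[of 1 a "k + 1 - a"] by simp
  also have "[a..<k+1] = a # (a + 1) # [a+2..<k+1]"
    using assms by (simp add: upt_rec[of a] upt_rec[of "Suc a"] Suc_eq_plus1[symmetric])
  finally show ?thesis by (simp add: idx_pairs_def)
qed

lemma signed_word_adj:
  assumes "I \<in> multi_idx m n k" "J \<in> multi_idx m n k" "1 \<le> a" "a < k"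
  shows "signed_word m (idx_pairs J I 1 k)
    + sc (swap_wt m q (I (a + 1)) (I a)) (signed_word m (idx_pairs J (I \<circ> adj a) 1 k))
    - sc (swap_wt m q (J a) (J (a + 1))) (signed_word m (idx_pairs (J \<circ> adj a) I 1 k)
        + sc (swap_wt m q (I (a + 1)) (I a)) (signed_word m (idx_pairs (J \<circ> adj a) (I \<circ> adj a) 1 k)))
    \<in> right_quantum_ideal m n q"
proof -
  let ?u = "map (\<lambda>b. (J b, I b)) [1..<a]" and ?v = "map (\<lambda>b. (J b, I b)) [a+2..<k+1]"
  have fix_adj: "map (\<lambda>b. (J (adj a b), I b)) [1..<a] = ?u" "map (\<lambda>b. (J (adj a b), I b)) [a+2..<k+1] = ?v"
    "map (\<lambda>b. (J b, I (adj a b))) [1..<a] = ?u" "map (\<lambda>b. (J b, I (adj a b))) [a+2..<k+1] = ?v"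
    "map (\<lambda>b. (J (adj a b), I (adj a b))) [1..<a] = ?u" "map (\<lambda>b. (J (adj a b), I (adj a b))) [a+2..<k+1] = ?v"
    by (auto simp: transpose_def)
  have r: "I b \<in> {1..m + n}" "J b \<in> {1..m + n}" if "1 \<le> b" "b \<le> k" for b
    using multi_idx_mem[OF assms(1), of b] multi_idx_mem[OF assms(2), of b] that by auto
  have "signed_word m (?u @ [(J a, I a), (J (a + 1), I (a + 1))] @ ?v)
    + sc (swap_wt m q (I (a + 1)) (I a)) (signed_word m (?u @ [(J a, I (a + 1)), (J (a + 1), I a)] @ ?v))
    - sc (swap_wt m q (J a) (J (a + 1))) (signed_word m (?u @ [(J (a + 1), I a), (J a, I (a + 1))] @ ?v)
        + sc (swap_wt m q (I (a + 1)) (I a)) (signed_word m (?u @ [(J (a + 1), I (a + 1)), (J a, I a)] @ ?v)))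
    \<in> right_quantum_ideal m n q"
    using assms(3,4) by (intro signed_word_rel) (auto intro!: r simp del: atLeastAtMost_iff)
  then show ?thesis
    unfolding idx_pairs_split[OF assms(3,4)] comp_apply fix_adj transpose_apply_first transpose_apply_second .
qed

text \<open>For \<open>s = adj a\<close> this change of index plays the role of cyclicity of the
  trace.\<close>

lemma sum_multi_idx_comp:
  assumes "s permutes {1..k}" "s \<circ> s = id"
  shows "(\<Sum>I\<in>multi_idx m n k. g I) = (\<Sum>I\<in>multi_idx m n k. g (I \<circ> s))"
  by (rule sum.reindex_bij_witness[of _ "\<lambda>I. I \<circ> s" "\<lambda>I. I \<circ> s"])
    (use assms multi_idx_comp in \<open>auto simp: comp_assoc simp del: comp_apply\<close>)

text \<open>In the two terms with \<open>adj a\<close> in front, replacing \<open>I\<close> by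
  \<open>I \<circ> adj a\<close> moves the transposition to the columns, as the factor 1 + P behind
  the \<open>M\<close>s does. At the back, \<open>adj a\<close> exchanges the rows
  \<open>I \<circ> y\<close>, as the factor 1 - P does. For each \<open>I\<close> the four summands
  then form a scalar multiple of the relation in \<open>signed_word_adj\<close>.\<close>

lemma trace_word_rel:
  assumes "q \<noteq> 0" "y permutes {1..k}" "1 \<le> a" "a < k"
  shows "trace_word m n q k y + trace_word m n q k (adj a \<circ> y)
    - (trace_word m n q k (y \<circ> adj a) + trace_word m n q k (adj a \<circ> y \<circ> adj a)) \<in> right_quantum_ideal m n q"
proof -
  let ?K = "multi_idx m n k" and ?s = "adj a"
  let ?sg = "\<lambda>I. (- 1) ^ (\<Sum>b = 1..k. par m (I b)) :: complex"
  let ?W = "\<lambda>J I. signed_word m (idx_pairs J I 1 k)"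
  let ?D = "\<lambda>J I. ?W J I + sc (swap_wt m q (I (a + 1)) (I a)) (?W J (I \<circ> ?s))
    - sc (swap_wt m q (J a) (J (a + 1))) (?W (J \<circ> ?s) I
        + sc (swap_wt m q (I (a + 1)) (I a)) (?W (J \<circ> ?s) (I \<circ> ?s)))"
  have s: "?s permutes {1..k}" using assms by (intro adj_permutes) auto
  have ss: "?s \<circ> ?s = id" by simp
  have sg: "?sg (I \<circ> ?s) = ?sg I" for I
    using sum.permute[OF s, of "\<lambda>b. par m (I b)"] by (simp add: comp_def)
  have rot: "I \<circ> ?s \<circ> (?s \<circ> z) = I \<circ> z" for I z :: "nat \<Rightarrow> nat"
    using ss by (metis comp_assoc comp_id)
  have adjv: "(I \<circ> ?s) a = I (a + 1)" "(I \<circ> ?s) (a + 1) = I a" for I :: "nat \<Rightarrow> nat"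
    by auto
  have ys: "perm_coef m q k I (y \<circ> ?s) = perm_coef m q k I y * swap_wt m q ((I \<circ> y) a) ((I \<circ> y) (a + 1))" for I
    by (simp only: perm_coef_compose[OF assms(1,2) s] perm_coef_adj[OF assms(1,3,4)])
  have sz: "perm_coef m q k (I \<circ> ?s) (?s \<circ> z) = swap_wt m q (I (a + 1)) (I a) * perm_coef m q k I z"
    if "z permutes {1..k}" for z I
  proof -
    have "I \<circ> ?s \<circ> ?s = I" using ss by (metis comp_assoc comp_id)
    then show ?thesis
      by (simp only: perm_coef_compose[OF assms(1) s that] perm_coef_adj[OF assms(1,3,4)] adjv)
  qed
  have t: "trace_word m n q k (?s \<circ> z) = (\<Sum>I\<in>?K. sc (?sg I * (swap_wt m q (I (a + 1)) (I a) * perm_coef m q k I z))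
      (?W (I \<circ> z) (I \<circ> ?s)))" if "z permutes {1..k}" for z
    unfolding trace_word_def by (subst sum_multi_idx_comp[OF s ss]) (simp only: sg sz[OF that] rot)
  have "trace_word m n q k y + trace_word m n q k (?s \<circ> y)
    - (trace_word m n q k (y \<circ> ?s) + trace_word m n q k (?s \<circ> (y \<circ> ?s)))
    = (\<Sum>I\<in>?K. sc (?sg I * perm_coef m q k I y) (?D (I \<circ> y) I))"
    unfolding t[OF assms(2)] t[OF permutes_compose[OF s assms(2)]]
    unfolding trace_word_def ys sum.distrib[symmetric] sum_subtractf[symmetric]
    by (intro sum.cong refl)
      (simp only: sc_add sc.scale_right_diff_distrib sc_sc comp_assoc mult.assoc mult.commute mult.left_commute)
  also have "\<dots> \<in> right_quantum_ideal m n q"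
    using assms(2-4) by (intro sc.subspace_sum[OF RI_subspace] RI_sc signed_word_adj multi_idx_comp)
  finally show ?thesis by (simp only: comp_assoc)
qed

lemma trace_word_carrier:
  assumes "\<sigma> permutes {1..k}"
  shows "trace_word m n q k \<sigma> \<in> free_carrier m n"
  unfolding trace_word_def
proof (intro free_carrier_sum free_carrier_sc signed_word_carrier)
  fix I assume I: "I \<in> multi_idx m n k"
  show "set (idx_pairs (I \<circ> \<sigma>) I 1 k) \<subseteq> {1..m + n} \<times> {1..m + n}"
    using multi_idx_mem[OF I] multi_idx_mem[OF multi_idx_comp[OF I assms]]
    unfolding idx_pairs_def by auto
qed

text \<open>A lift to the free algebra of the left-hand sides of both identities.\<close>

definition master_sum :: "((nat \<Rightarrow> nat) \<Rightarrow> complex) \<Rightarrow> ((nat \<Rightarrow> nat) \<Rightarrow> complex) \<Rightarrow>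
    nat \<Rightarrow> nat \<Rightarrow> complex \<Rightarrow> nat \<Rightarrow> free_alg" where
  "master_sum \<chi> \<chi>' m n q k = (\<Sum>r = 0..k. sc ((- 1) ^ r) (sc (1 / fact r * (1 / fact (k - r)))
    (\<Sum>\<sigma> | \<sigma> permutes {1..r}. \<Sum>\<tau> | \<tau> permutes {r+1..k}.
      sc (\<chi> \<sigma> * \<chi>' \<tau>) (trace_word m n q k (\<sigma> \<circ> \<tau>)))))"

text \<open>Membership is tested by the functionals \<open>l\<close> that vanish on the ideal: by
  \<open>trace_word_rel\<close>, \<open>l\<close> composed with \<open>trace_word\<close> is a
  \<open>mixed_functional\<close>, so \<open>l\<close> annihilates both sums.\<close>

lemma master_sum_RI:
  assumes "q \<noteq> 0" "k \<ge> 1"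
  shows "master_sum (\<lambda>_. 1) (\<lambda>\<tau>. of_int (sign \<tau>)) m n q k \<in> right_quantum_ideal m n q" (is "?A \<in> ?I")
    and "master_sum (\<lambda>\<sigma>. of_int (sign \<sigma>)) (\<lambda>_. 1) m n q k \<in> right_quantum_ideal m n q" (is "?B \<in> ?I")
proof -
  have zero: "l ?A = 0 \<and> l ?B = 0"
    if l: "Vector_Spaces.linear sc (*) l" and I: "\<And>y. y \<in> ?I \<Longrightarrow> l y = 0" for l :: "free_alg \<Rightarrow> complex"
  proof -
    interpret l: Vector_Spaces.linear sc "(*)" l by (rule l)
    interpret mixed_functional "\<lambda>\<sigma>. l (trace_word m n q k \<sigma>)" k
    proof
      fix a and y :: "nat \<Rightarrow> nat" assume "y permutes {1..k}" "1 \<le> a" "a < k"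
      then have "l (trace_word m n q k y + trace_word m n q k (adj a \<circ> y)
        - (trace_word m n q k (y \<circ> adj a) + trace_word m n q k (adj a \<circ> y \<circ> adj a))) = 0"
        by (intro I trace_word_rel assms)
      then show "l (trace_word m n q k y) + l (trace_word m n q k (adj a \<circ> y)) =
        l (trace_word m n q k (y \<circ> adj a)) + l (trace_word m n q k (adj a \<circ> y \<circ> adj a))"
        by (simp only: l.diff l.add) simp
    qed
    show ?thesis
      using alternating_sym_antisym[OF assms(2)] alternating_antisym_sym[OF assms(2)]
      unfolding master_sum_def by (simp only: l.sum l.scale mult_1_left mult_1_right mult.assoc)
  qed
  have "x \<in> ?I" if x: "\<And>l. \<lbrakk>Vector_Spaces.linear sc (*) l; \<And>y. y \<in> ?I \<Longrightarrow> l y = 0\<rbrakk> \<Longrightarrow> l x = 0" for x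
  proof (rule ccontr)
    assume "x \<notin> ?I"
    then obtain l where "Vector_Spaces.linear sc (*) l" "\<And>y. y \<in> ?I \<Longrightarrow> l y = 0" "l x \<noteq> 0"
      using separating_functional[OF RI_subspace] by blast
    with x show False by blast
  qed
  then show "?A \<in> ?I" "?B \<in> ?I"
    using zero by blast+
qed

theorem theorem2p4:
  fixes m n k :: nat and q :: complex
  assumes "q \<noteq> 0" and "k \<ge> 1"
  shows
    "let R = right_quantum_superalgebra m n q;
         T = tensor_End R m n k;
         M = (\<lambda>a. M_op R m n (gen m n q) k a);
         MM = ordered_prod T (map M [1..<k + 1]);
         H = q_sym R m n q k;
         A = q_antisym R m n q k;
         str = supertrace R m n k
     in
       (\<Oplus>\<^bsub>R\<^esub>r \<in> {0..k}. ((- 1) ^ r) \<odot>\<^bsub>R\<^esub>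
          str (H 1 r \<otimes>\<^bsub>T\<^esub> A (r + 1) k \<otimes>\<^bsub>T\<^esub> MM)) = \<zero>\<^bsub>R\<^esub> \<and>
       (\<Oplus>\<^bsub>R\<^esub>r \<in> {0..k}. ((- 1) ^ r) \<odot>\<^bsub>R\<^esub>
          str (A 1 r \<otimes>\<^bsub>T\<^esub> H (r + 1) k \<otimes>\<^bsub>T\<^esub> MM)) = \<zero>\<^bsub>R\<^esub>"
proof -
  let ?R = "right_quantum_superalgebra m n q"
  let ?T = "tensor_End ?R m n k"
  let ?\<pi> = "\<lambda>f. right_quantum_ideal m n q +>\<^bsub>free_superalgebra m n\<^esub> f"
  interpret free_image m n ?R ?\<pi> by (rule free_image_quotient)
  let ?MM = "ordered_prod ?T (map (M_op ?R m n (gen m n q) k) [1..<k + 1])"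
  have MM: "rep k (M_tail m k 1) ?MM"
    by (rule rep_M_tail) (auto simp: gen_def)
  have main: "(\<Oplus>\<^bsub>?R\<^esub>r \<in> {0..k}. ((- 1) ^ r) \<odot>\<^bsub>?R\<^esub>
      supertrace ?R m n k (X r \<otimes>\<^bsub>?T\<^esub> Y r \<otimes>\<^bsub>?T\<^esub> ?MM)) = \<zero>\<^bsub>?R\<^esub>"
    if X: "\<And>r. r \<le> k \<Longrightarrow> rep k (sym_mat \<chi> m q k 1 r) (X r)"
      and Y: "\<And>r. r \<le> k \<Longrightarrow> rep k (sym_mat \<chi>' m q k (r + 1) k) (Y r)"
      and mem: "master_sum \<chi> \<chi>' m n q k \<in> right_quantum_ideal m n q" for \<chi> \<chi>' X Y
  proof -
    let ?f = "\<lambda>r. sc (1 / fact r * (1 / fact (k - r))) (\<Sum>\<sigma> | \<sigma> permutes {1..r}. \<Sum>\<tau> | \<tau> permutes {r+1..k}.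
      sc (\<chi> \<sigma> * \<chi>' \<tau>) (trace_word m n q k (\<sigma> \<circ> \<tau>)))"
    have carr: "?f r \<in> free_carrier m n" if "r \<le> k" for r
      using that by (intro free_carrier_sc free_carrier_sum trace_word_carrier permutes_compose)
        (auto intro: permutes_subset)
    have "(\<Oplus>\<^bsub>?R\<^esub>r \<in> {0..k}. ((- 1) ^ r) \<odot>\<^bsub>?R\<^esub>
      supertrace ?R m n k (X r \<otimes>\<^bsub>?T\<^esub> Y r \<otimes>\<^bsub>?T\<^esub> ?MM)) = ?\<pi> (\<Sum>r = 0..k. sc ((- 1) ^ r) (?f r))"
    proof (rule finsum_eq_pi)
      fix r assume "r \<in> {0..k}"
      then have r: "r \<le> k" by simp
      show "sc ((- 1) ^ r) (?f r) \<in> free_carrier m n"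
        using carr[OF r] by (rule free_carrier_sc)
      show "(- 1) ^ r \<odot>\<^bsub>?R\<^esub> supertrace ?R m n k (X r \<otimes>\<^bsub>?T\<^esub> Y r \<otimes>\<^bsub>?T\<^esub> ?MM) = ?\<pi> (sc ((- 1) ^ r) (?f r))"
        unfolding supertrace_sym_mat[OF assms(1) r X[OF r] Y[OF r] MM] pi_smult[OF carr[OF r]] ..
    qed simp
    also have "\<dots> = ?\<pi> (master_sum \<chi> \<chi>' m n q k)"
      unfolding master_sum_def ..
    also have "\<dots> = ?\<pi> 0"
      unfolding coset_eq_iff using mem by simp
    finally show ?thesis unfolding pi_zero .
  qed
  show ?thesis
    unfolding Let_def
    by (intro conjI main[OF rep_q_sym rep_q_antisym master_sum_RI(1)]
        main[OF rep_q_antisym rep_q_sym master_sum_RI(2)] assms) simp_all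
qed

end
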